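(* Consider the stochastic mirror descent iteration $\{x_n^\delta,\xi_n^\delta\}$ with fixed step-sizes $t_I$ described in the context. Assume that $0<t_I<4\sigma/\|A_I\|^2$ for all subsets $I\subset\{1,\dots,p\}$ with $|I|=b$; furthermore, $t_I=t$ with a constant $t$ for all such $I$ in case $b>1$. If the sought solution $x^\dagger$ satisfies the source condition $$A^*\lambda^\dagger\in\partial\mathcal R(x^\dagger)\quad\text{for some }\lambda^\dagger=(\lambda^\dagger_{,1},\dots,\lambda^\dagger_{,p})\in Y,$$ and the integer $n_\delta$ is chosen such that $1+\frac bp n_\delta$ is of the magnitude of $\delta^{-1}$ (i.e. bounded above and below by fixed positive constant multiples of $\delta^{-1}$), then $$\mathbb{E}\left[\|x_{n_\delta}^\delta-x^\dagger\|^2\right]\le C\delta,$$ where $C$ is a positive constant independent of $\delta$, $p$ and $b$.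
   Context: Setting. $X$ is a Banach space with dual $X^*$ and duality pairing $\langle\cdot,\cdot\rangle$; $Y_1,\dots,Y_p$ are Hilbert spaces (identified with their duals), and $Y:=Y_1\times\cdots\times Y_p$ is the product Hilbert space; $\lambda_{,i}$ denotes the $i$-th component of $\lambda\in Y$. For $i=1,\dots,p$, $A_i:X\to Y_i$ is a bounded linear operator; $Ax:=(A_1x,\dots,A_px)$, and $A^*:Y\to X^*$ is the adjoint of $A:X\to Y$. $\mathcal R:X\to(-\infty,\infty]$ is proper, lower semi-continuous and strongly convex with modulus of convexity $\sigma>0$, i.e. $\sigma$ is the largest number such that $\mathcal R(s\bar x+(1-s)x)+\sigma s(1-s)\|\bar x-x\|^2\le s\mathcal R(\bar x)+(1-s)\mathcal R(x)$ for all $\bar x,x\in\mathrm{dom}(\mathcal R):=\{x\in X:\mathcal R(x)<\infty\}$ and $s\in[0,1]$. $\partial\mathcal R$ denotes the subdifferential of $\mathcal R$. The system $A_ix=y_i$, $i=1,\dots,p$, with exact data $y_i\in Y_i$, has a solution in $\mathrm{dom}(\mathcal R)$; the sought solution $x^\dagger$ is its unique $\mathcal R$-minimizing solution (the unique solution minimizing $\mathcal R$ among all solutions). Noisy data. $y_i^\delta\in Y_i$ satisfy $\|y_i^\delta-y_i\|\le\delta_i$ with $\delta_i>0$, $i=1,\dots,p$, and $\delta:=(\delta_1^2+\dots+\delta_p^2)^{1/2}$ is the total noise level. For $I=\{i_1,\dots,i_b\}\subset\{1,\dots,p\}$ put $Y_I:=Y_{i_1}\times\cdots\times Y_{i_b}$,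 $A_Ix:=(A_{i_1}x,\dots,A_{i_b}x)\in Y_I$, $y_I^\delta:=(y_{i_1}^\delta,\dots,y_{i_b}^\delta)$, and let $A_I^*:Y_I\to X^*$ be the adjoint of $A_I$. Algorithm (mini-batch stochastic mirror descent with fixed step-sizes). Fix a batch size $b\in\{1,\dots,p\}$ and step-sizes $t_I$ for all $I\subset\{1,\dots,p\}$ with $|I|=b$. Set $\xi_0^\delta:=0\in X^*$. For $n\ge0$: (i) let $x_n^\delta:=\arg\min_{x\in X}\{\mathcal R(x)-\langle\xi_n^\delta,x\rangle\}$ (the minimizer exists and is unique); (ii) randomly select a subset $I_n\subset\{1,\dots,p\}$ with $|I_n|=b$ via the uniform distribution, independently of the previous selections; (iii) set $$\xi_{n+1}^\delta:=\xi_n^\delta-t_{I_n}A_{I_n}^*(A_{I_n}x_n^\delta-y_{I_n}^\delta).$$ $\mathbb E$ denotes the expectation with respect to the random selections $I_0,I_1,\dots$. *)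

theory Defs
  imports "HOL-Probability.Probability"
begin

section \<open>Convex analysis for functions with values in the extended reals\<close>

definition proper_fun :: "('x \<Rightarrow> ereal) \<Rightarrow> bool" where
  "proper_fun R \<longleftrightarrow> (\<forall>x. R x \<noteq> -\<infinity>) \<and> (\<exists>x. R x < \<infinity>)"

definition lower_semicont :: "('x::topological_space \<Rightarrow> ereal) \<Rightarrow> bool" where
  "lower_semicont R \<longleftrightarrow> (\<forall>x. R x \<le> Liminf (at x) R)"

definition effdom :: "('x \<Rightarrow> ereal) \<Rightarrow> 'x set" where
  "effdom R = {x. R x < \<infinity>}"

text \<open>There is no factor 1/2 in front of the quadratic term.\<close>

definition strong_convexity_ineq :: "('x::real_normed_vector \<Rightarrow> ereal) \<Rightarrow> real \<Rightarrow> bool" where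
  "strong_convexity_ineq R \<sigma> \<longleftrightarrow>
     (\<forall>x'\<in>effdom R. \<forall>x\<in>effdom R. \<forall>s\<in>{0..1}.
        R (s *\<^sub>R x' + (1 - s) *\<^sub>R x) + ereal (\<sigma> * s * (1 - s) * (norm (x' - x))\<^sup>2)
          \<le> ereal s * R x' + ereal (1 - s) * R x)"

definition modulus_of_convexity :: "('x::real_normed_vector \<Rightarrow> ereal) \<Rightarrow> real \<Rightarrow> bool" where
  "modulus_of_convexity R \<sigma> \<longleftrightarrow>
     strong_convexity_ineq R \<sigma> \<and> (\<forall>\<sigma>'. strong_convexity_ineq R \<sigma>' \<longrightarrow> \<sigma>' \<le> \<sigma>)"

definition subdifferential ::
  "('x::real_normed_vector \<Rightarrow> ereal) \<Rightarrow> 'x \<Rightarrow> ('x \<Rightarrow>\<^sub>L real) set" where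
  "subdifferential R x = {\<xi>. \<forall>z. R x + ereal (blinfun_apply \<xi> (z - x)) \<le> R z}"


section \<open>The linear system\<close>

text \<open>
  The Hilbert spaces \<open>Y\<^sub>1, \<dots>, Y\<^sub>p\<close> may differ from each other.  They are closed subspaces
  \<open>Y i\<close> of one Hilbert space, which is no restriction up to isometry since every family of
  Hilbert spaces embeds into its Hilbert sum.  An element of \<open>Y\<^sub>I\<close> is a function that is
  only used at the indices in \<open>I\<close>; its norm is \<open>L2_set (\<lambda>i. norm (v i)) I\<close>.
\<close>

definition hilbert_components ::
  "nat \<Rightarrow> (nat \<Rightarrow> 'h::{real_inner, complete_space} set) \<Rightarrow> bool" where
  "hilbert_components p Y \<longleftrightarrow> (\<forall>i\<in>{1..p}. subspace (Y i) \<and> closed (Y i))"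

definition solves ::
  "nat \<Rightarrow> (nat \<Rightarrow> 'x::real_normed_vector \<Rightarrow>\<^sub>L 'h::real_normed_vector) \<Rightarrow> (nat \<Rightarrow> 'h) \<Rightarrow> 'x \<Rightarrow> bool"
  where "solves p A y x \<longleftrightarrow> (\<forall>i\<in>{1..p}. A i x = y i)"

definition unique_minimizing_solution ::
  "('x::real_normed_vector \<Rightarrow> ereal) \<Rightarrow> nat \<Rightarrow> (nat \<Rightarrow> 'x \<Rightarrow>\<^sub>L 'h::real_normed_vector)
     \<Rightarrow> (nat \<Rightarrow> 'h) \<Rightarrow> 'x \<Rightarrow> bool" where
  "unique_minimizing_solution R p A y x \<longleftrightarrow>
     is_arg_min R (solves p A y) x \<and> (\<forall>z. is_arg_min R (solves p A y) z \<longrightarrow> z = x)"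

text \<open>The operator norm of \<open>A\<^sub>I : X \<rightarrow> Y\<^sub>I\<close>, written as in \<^const>\<open>onorm\<close>.\<close>

definition block_norm ::
  "(nat \<Rightarrow> 'x::real_normed_vector \<Rightarrow>\<^sub>L 'h::real_normed_vector) \<Rightarrow> nat set \<Rightarrow> real" where
  "block_norm A I = (SUP x. L2_set (\<lambda>i. norm (A i x)) I / norm x)"

text \<open>The adjoint of \<open>A\<^sub>I\<close>: it maps \<open>v\<close> to the functional \<open>x \<mapsto> \<Sum>i\<in>I. v i \<bullet> A i x\<close>.\<close>

definition block_adjoint ::
  "(nat \<Rightarrow> 'x::real_normed_vector \<Rightarrow>\<^sub>L 'h::real_inner) \<Rightarrow> nat set \<Rightarrow> (nat \<Rightarrow> 'h) \<Rightarrow> 'x \<Rightarrow>\<^sub>L real"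
  where "block_adjoint A I v = (\<Sum>i\<in>I. blinfun_inner_right (v i) o\<^sub>L A i)"


section \<open>Mini-batch stochastic mirror descent\<close>

definition batches :: "nat \<Rightarrow> nat \<Rightarrow> nat set set" where
  "batches p b = {I. I \<subseteq> {1..p} \<and> card I = b}"

definition mirror_map ::
  "('x::real_normed_vector \<Rightarrow> ereal) \<Rightarrow> ('x \<Rightarrow>\<^sub>L real) \<Rightarrow> 'x" where
  "mirror_map R \<xi> = arg_min (\<lambda>x. R x - ereal (blinfun_apply \<xi> x)) (\<lambda>_. True)"

text \<open>The iterates along one realization \<open>I 0, I 1, \<dots>\<close> of the selected batches.\<close>

primrec smd_dual ::
  "('x::real_normed_vector \<Rightarrow> ereal) \<Rightarrow> (nat \<Rightarrow> 'x \<Rightarrow>\<^sub>L 'h::real_inner) \<Rightarrow> (nat \<Rightarrow> 'h)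
     \<Rightarrow> (nat set \<Rightarrow> real) \<Rightarrow> (nat \<Rightarrow> nat set) \<Rightarrow> nat \<Rightarrow> 'x \<Rightarrow>\<^sub>L real" where
  "smd_dual R A y t I 0 = 0"
| "smd_dual R A y t I (Suc n) =
     smd_dual R A y t I n
       - t (I n) *\<^sub>R block_adjoint A (I n) (\<lambda>i. A i (mirror_map R (smd_dual R A y t I n)) - y i)"

definition smd_primal ::
  "('x::real_normed_vector \<Rightarrow> ereal) \<Rightarrow> (nat \<Rightarrow> 'x \<Rightarrow>\<^sub>L 'h::real_inner) \<Rightarrow> (nat \<Rightarrow> 'h)
     \<Rightarrow> (nat set \<Rightarrow> real) \<Rightarrow> (nat \<Rightarrow> nat set) \<Rightarrow> nat \<Rightarrow> 'x" where
  "smd_primal R A y t I n = mirror_map R (smd_dual R A y t I n)"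

definition uniform_selections ::
  "nat \<Rightarrow> nat \<Rightarrow> 'w measure \<Rightarrow> (nat \<Rightarrow> 'w \<Rightarrow> nat set) \<Rightarrow> bool" where
  "uniform_selections p b M I \<longleftrightarrow>
     prob_space M \<and>
     prob_space.indep_vars M (\<lambda>_. count_space (batches p b)) I UNIV \<and>
     (\<forall>n. distr M (count_space (batches p b)) (I n) = uniform_count_measure (batches p b))"

text \<open>
  The step-size rule.  The quotient is taken in the extended reals, where division of a
  positive number by 0 gives \<open>\<infinity>\<close>, so that there is no upper bound when \<open>A\<^sub>I = 0\<close>.
\<close>

definition admissible_steps ::
  "nat \<Rightarrow> nat \<Rightarrow> real \<Rightarrow> (nat \<Rightarrow> 'x::real_normed_vector \<Rightarrow>\<^sub>L 'h::real_normed_vector)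
     \<Rightarrow> (nat set \<Rightarrow> real) \<Rightarrow> bool" where
  "admissible_steps p b \<sigma> A t \<longleftrightarrow>
     (\<forall>I\<in>batches p b. 0 < t I \<and> ereal (t I) < ereal (4 * \<sigma>) / ereal ((block_norm A I)\<^sup>2)) \<and>
     (b > 1 \<longrightarrow> (\<exists>\<tau>. \<forall>I\<in>batches p b. t I = \<tau>))"

end

theory Submission
  imports Defs
begin

text \<open>
  The idea is to read the iteration in the space of multipliers. Every dual iterate has the form
  \<open>\<xi> = A\<^sup>* \<eta>\<close> with \<open>\<eta> \<in> Y\<close>, and in terms of \<open>\<eta>\<close> the method is randomized block coordinate descent
  for the convex function \<open>F \<eta> = R\<^sup>* (A\<^sup>* \<eta>) - \<langle>\<eta>, y\<^sup>\<delta>\<rangle>\<close>: the gradient of \<open>R\<^sup>*\<close> at \<open>\<xi>\<close> is the mirror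
  point, so the gradient of \<open>F\<close> is the residual \<open>A x - y\<^sup>\<delta>\<close>. The source condition says that
  \<open>\<lambda>\<^sup>\<dagger>\<close> minimizes \<open>F\<close> when the data are exact, and the Fenchel-Young inequality, sharpened by strong
  convexity, gives
  \<open>\<sigma> \<parallel>x - x\<^sup>\<dagger>\<parallel>\<^sup>2 \<le> F \<eta> - F \<lambda>\<^sup>\<dagger> + \<langle>\<eta> - \<lambda>\<^sup>\<dagger>, y\<^sup>\<delta> - y\<rangle>\<close>.
  So the error is controlled by the objective gap of a descent method, up to a noise term
  that is at most \<open>\<delta> \<parallel>\<eta> - \<lambda>\<^sup>\<dagger>\<parallel>\<close>.
  
  Two facts about one step on a batch \<open>J\<close> drive the proof. Strong convexity makes \<open>R\<^sup>*\<close> smooth, and the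
  step-size bound then makes \<open>F\<close> decrease by at least \<open>c t\<^sub>J \<parallel>residual on J\<parallel>\<^sup>2\<close>, where
  \<open>c = 1 - max\<^sub>I t\<^sub>I \<parallel>A\<^sub>I\<parallel>\<^sup>2 / (4 \<sigma>) > 0\<close>. The squared distance \<open>W\<close> to \<open>\<lambda>\<^sup>\<dagger>\<close>,
  weighted by the inverse step-sizes, grows by \<open>t\<^sub>J \<parallel>residual on J\<parallel>\<^sup>2\<close> minus twice the pairing of
  \<open>\<eta> - \<lambda>\<^sup>\<dagger>\<close> with the residual on \<open>J\<close>. The first fact absorbs the quadratic term of the second. The mean
  over the uniformly drawn \<open>J\<close> of the pairing is \<open>b/p\<close> times the full pairing, which is at least
  \<open>F \<eta> - F \<lambda>\<^sup>\<dagger>\<close> by convexity. Hence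
  \<open>E [W\<^sub>n + N\<^sub>n (F \<eta>\<^sub>n - F \<lambda>\<^sup>\<dagger>)]\<close> with \<open>N\<^sub>n = 1/c + 2 b n / p\<close> is nonincreasing in \<open>n\<close>
  (\<open>lyapunov_decreasing\<close>).
  
  To conclude, \<open>N\<^sub>n\<close> times the noise term is at most \<open>W\<^sub>n + (N\<^sub>n \<delta>)\<^sup>2 t\<^sub>m\<^sub>a\<^sub>x / 4\<close> by Young's
  inequality, so \<open>N\<^sub>n \<sigma> E \<parallel>x\<^sub>n - x\<^sup>\<dagger>\<parallel>\<^sup>2\<close> is bounded by the initial value of the Lyapunov function plus
  \<open>(N\<^sub>n \<delta>)\<^sup>2 t\<^sub>m\<^sub>a\<^sub>x / 4\<close> (\<open>gain_expected_error_le\<close>). The choice of the stopping index makes \<open>N\<^sub>n\<close>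
  comparable with \<open>1/\<delta>\<close>, and division by \<open>N\<^sub>n \<sigma>\<close> leaves a bound of order \<open>\<delta>\<close> whose constant contains
  neither \<open>p\<close> nor \<open>b\<close>.
\<close>

section \<open>Strongly convex functionals and the mirror map\<close>

locale strongly_convex_functional =
  fixes R :: "'x::banach \<Rightarrow> ereal" and \<sigma> :: real
  assumes proper: "proper_fun R"
    and lsc: "lower_semicont R"
    and strongly_convex: "strong_convexity_ineq R \<sigma>"
    and sigma_pos: "\<sigma> > 0"
begin

abbreviation D :: "'x set" where "D \<equiv> effdom R"

text \<open>
  On the effective domain \<open>R\<close> is a real function; all inequalities below are stated for it,
  so that extended-real arithmetic stays confined to the first few lemmas.
\<close>
definition r :: "'x \<Rightarrow> real" where "r x = real_of_ereal (R x)"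

lemma R_eq_r: "x \<in> D \<Longrightarrow> R x = ereal (r x)"
  using proper unfolding proper_fun_def effdom_def r_def
  by (cases "R x") auto

lemma R_outside: "x \<notin> D \<Longrightarrow> R x = \<infinity>"
  unfolding effdom_def by auto

lemma D_nonempty: "D \<noteq> {}"
  using proper unfolding proper_fun_def effdom_def by auto

lemma r_strongly_convex:
  assumes "x' \<in> D" "x \<in> D" "0 \<le> s" "s \<le> 1"
  shows "s *\<^sub>R x' + (1 - s) *\<^sub>R x \<in> D" (is "?z \<in> D")
    and "r (s *\<^sub>R x' + (1 - s) *\<^sub>R x) + \<sigma> * s * (1 - s) * (norm (x' - x))\<^sup>2
          \<le> s * r x' + (1 - s) * r x"
proof -
  have le: "R ?z + ereal (\<sigma> * s * (1 - s) * (norm (x' - x))\<^sup>2) \<le> ereal (s * r x' + (1 - s) * r x)"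
    using strongly_convex assms unfolding strong_convexity_ineq_def by (auto simp: R_eq_r)
  show z: "?z \<in> D"
  proof (rule ccontr)
    assume "?z \<notin> D"
    then show False using le R_outside by auto
  qed
  show "r ?z + \<sigma> * s * (1 - s) * (norm (x' - x))\<^sup>2 \<le> s * r x' + (1 - s) * r x"
    using le by (simp add: R_eq_r[OF z])
qed

lemma eventually_above:
  assumes "ereal c < R x"
  shows "eventually (\<lambda>z. ereal c < R z) (nhds x)"
proof -
  have "ereal c < Liminf (at x) R"
    using lsc assms unfolding lower_semicont_def by (meson less_le_trans)
  then have "eventually (\<lambda>z. ereal c < R z) (at x)"
    by (rule less_LiminfD)
  then show ?thesis
    using assms by (auto simp: eventually_at_filter elim: eventually_mono)
qed

text \<open>
  Lower semicontinuity in the form used for minimizing sequences. It yields membership of the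
  limit in the domain as well, because a bound on \<open>r\<close> along the sequence keeps \<open>R\<close> finite in the limit.
\<close>
lemma r_closed:
  assumes "\<And>k. z k \<in> D" and "z \<longlonglongrightarrow> x" and "\<And>k::nat. r (z k) \<le> c k" and "c \<longlonglongrightarrow> c'"
  shows "x \<in> D" and "r x \<le> c'"
proof -
  have "R x \<le> ereal c'"
  proof (rule ccontr)
    assume "\<not> R x \<le> ereal c'"
    then obtain d where d: "ereal c' < ereal d" "ereal d < R x"
      by (metis ereal_dense2 not_le)
    from filterlim_iff[THEN iffD1, OF \<open>z \<longlonglongrightarrow> x\<close>, rule_format, OF eventually_above[OF d(2)]]
    have "eventually (\<lambda>k. d \<le> c k) sequentially"
    proof (rule eventually_mono)
      fix k assume "ereal d < R (z k)"
      then show "d \<le> c k" using assms(3)[of k] by (simp add: R_eq_r[OF assms(1)])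
    qed
    with \<open>c \<longlonglongrightarrow> c'\<close> have "d \<le> c'"
      by (metis tendsto_lowerbound trivial_limit_sequentially)
    with d show False by simp
  qed
  then show "x \<in> D" unfolding effdom_def by auto
  with \<open>R x \<le> ereal c'\<close> show "r x \<le> c'" by (simp add: R_eq_r)
qed

lemma tilted_strongly_convex:
  fixes \<xi> :: "'x \<Rightarrow>\<^sub>L real"
  assumes "x' \<in> D" "x \<in> D" "0 \<le> s" "s \<le> 1"
  defines "z \<equiv> s *\<^sub>R x' + (1 - s) *\<^sub>R x"
  shows "r z - \<xi> z + \<sigma> * s * (1 - s) * (norm (x' - x))\<^sup>2
      \<le> s * (r x' - \<xi> x') + (1 - s) * (r x - \<xi> x)"
proof -
  have "\<xi> z = s * \<xi> x' + (1 - s) * \<xi> x"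
    by (simp add: z_def blinfun.add_right blinfun.scaleR_right)
  then show ?thesis
    using r_strongly_convex(2)[OF assms(1-4), folded z_def] by (simp only: right_diff_distrib)
qed

text \<open>
  A direct argument that avoids a continuous affine minorant of \<open>R\<close>. Lower semicontinuity bounds
  the tilted function from below on a small ball around a point \<open>x0\<close> of the domain. For a point \<open>x\<close> at
  a larger distance \<open>d\<close>, strong convexity along the segment from \<open>x0\<close> to \<open>x\<close>, evaluated
  where the segment is still in the ball, forces the value at \<open>x\<close> to be at least
  \<open>g x0 + \<sigma> d\<^sup>2 - L d\<close>, and this is bounded below in \<open>d\<close>.
\<close>
lemma tilted_bounded_below:
  fixes \<xi> :: "'x \<Rightarrow>\<^sub>L real"
  shows "bdd_below ((\<lambda>x. r x - \<xi> x) ` D)"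
proof -
  obtain x0 where x0: "x0 \<in> D" using D_nonempty by auto
  define g where "g = (\<lambda>x. r x - \<xi> x)"
  have "eventually (\<lambda>z. ereal (r x0 - 1) < R z) (nhds x0)"
    by (rule eventually_above) (simp add: R_eq_r[OF x0])
  moreover have "eventually (\<lambda>z. \<xi> z < \<xi> x0 + 1) (nhds x0)"
    by (rule order_tendstoD(2)[where y = "\<xi> x0"])
      (auto intro!: tendsto_intros filterlim_ident)
  ultimately have "eventually (\<lambda>z. ereal (r x0 - 1) < R z \<and> \<xi> z < \<xi> x0 + 1) (nhds x0)"
    by (rule eventually_conj)
  then obtain \<rho> where \<rho>: "\<rho> > 0"
    and near: "\<And>z. dist z x0 < \<rho> \<Longrightarrow> ereal (r x0 - 1) < R z \<and> \<xi> z < \<xi> x0 + 1"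
    by (auto simp: eventually_nhds_metric)
  have near': "g x0 - 2 \<le> g z" if "z \<in> D" "dist z x0 < \<rho>" for z
    using near[OF that(2)] that(1) by (simp add: g_def R_eq_r)
  define a where "a = \<rho> / 2"
  have a: "a > 0" "a < \<rho>" using \<rho> by (auto simp: a_def)
  \<comment> \<open>The minimum over \<open>d\<close> of \<open>\<sigma> d\<^sup>2 - L d\<close> is \<open>- L\<^sup>2 / (4 \<sigma>)\<close>; the 2 bounds the drop of \<open>g\<close> on the ball.\<close>
  define L where "L = 2 / a + \<sigma> * a"
  have "g x0 - 2 - L\<^sup>2 / (4 * \<sigma>) \<le> g x" if x: "x \<in> D" for x
  proof (cases "dist x x0 < \<rho>")
    case True
    have "0 \<le> L\<^sup>2 / (4 * \<sigma>)" using sigma_pos by simp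
    with near'[OF x True] show ?thesis by linarith
  next
    case False
    define d where "d = norm (x - x0)"
    have d: "d \<ge> \<rho>" using False by (simp add: d_def dist_norm)
    \<comment> \<open>With this parameter the point on the segment has distance \<open>a\<close> from \<open>x0\<close>.\<close>
    define s where "s = a / d"
    have s: "0 < s" "s \<le> 1" using a d by (auto simp: s_def)
    let ?z = "s *\<^sub>R x + (1 - s) *\<^sub>R x0"
    have "?z - x0 = s *\<^sub>R (x - x0)" by (simp add: algebra_simps)
    then have "dist ?z x0 = s * d" using s by (simp add: dist_norm d_def)
    also have "\<dots> = a" using a d by (simp add: s_def)
    finally have "g x0 - 2 \<le> g ?z"
      using near' r_strongly_convex(1)[OF x x0, of s] s a by auto
    with tilted_strongly_convex[OF x x0, of s \<xi>] s
    have "g x0 - 2 + \<sigma> * s * (1 - s) * d\<^sup>2 \<le> s * g x + (1 - s) * g x0"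
      by (simp add: g_def d_def)
    then have "s * (g x0 + \<sigma> * (1 - s) * d\<^sup>2) - 2 \<le> s * g x"
      by (simp add: algebra_simps)
    then have "(s * (g x0 + \<sigma> * (1 - s) * d\<^sup>2) - 2) / s \<le> g x"
      using s by (simp add: pos_divide_le_eq mult.commute)
    then have "g x0 + \<sigma> * (1 - s) * d\<^sup>2 - 2 / s \<le> g x"
      using s by (simp add: diff_divide_distrib)
    moreover have "\<sigma> * (1 - s) * d\<^sup>2 - 2 / s = \<sigma> * d\<^sup>2 - L * d"
      using a d \<rho> by (simp add: s_def L_def field_simps power2_eq_square)
    moreover have "\<sigma> * d\<^sup>2 - L * d + L\<^sup>2 / (4 * \<sigma>) = \<sigma> * (d - L / (2 * \<sigma>))\<^sup>2"
      using sigma_pos by (simp add: field_simps power2_eq_square)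
    moreover have "0 \<le> \<sigma> * (d - L / (2 * \<sigma>))\<^sup>2" using sigma_pos by simp
    ultimately show ?thesis by linarith
  qed
  then show ?thesis unfolding g_def by (intro bdd_belowI2)
qed

text \<open>
  The midpoint of two nearly minimal points would lie below the infimum if the points were
  far apart; so a minimizing sequence is Cauchy, and its limit is a minimizer by lower semicontinuity.
\<close>
lemma tilted_attains_minimum:
  fixes \<xi> :: "'x \<Rightarrow>\<^sub>L real"
  shows "\<exists>m\<in>D. \<forall>x\<in>D. r m - \<xi> m \<le> r x - \<xi> x"
proof -
  define g where "g = (\<lambda>x. r x - \<xi> x)"
  define \<mu> where "\<mu> = Inf (g ` D)"
  have bdd: "bdd_below (g ` D)" using tilted_bounded_below[of \<xi>] by (simp add: g_def)
  have mu_le: "\<mu> \<le> g x" if "x \<in> D" for x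
    unfolding \<mu>_def using bdd that by (auto intro: cInf_lower)
  have "\<exists>x\<in>D. g x < \<mu> + 1 / real (Suc k)" for k
    using cInf_lessD[of "g ` D" "\<mu> + 1 / real (Suc k)"] D_nonempty by (auto simp: \<mu>_def)
  then obtain z where z: "\<And>k. z k \<in> D" "\<And>k. g (z k) < \<mu> + 1 / real (Suc k)"
    by metis
  have gap: "\<sigma> / 4 * (norm (z k - z l))\<^sup>2 \<le> 1 / real (Suc N)" if "k \<ge> N" "l \<ge> N" for k l N
  proof -
    let ?m = "(1/2) *\<^sub>R z k + (1 - 1/2) *\<^sub>R z l"
    have "\<mu> \<le> g ?m" by (intro mu_le r_strongly_convex(1) z) auto
    moreover have "g ?m + \<sigma> * (1/2) * (1 - 1/2) * (norm (z k - z l))\<^sup>2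
        \<le> (1/2) * g (z k) + (1 - 1/2) * g (z l)"
      unfolding g_def by (rule tilted_strongly_convex[OF z(1) z(1)]) auto
    moreover have "1 / real (Suc k) \<le> 1 / real (Suc N)" "1 / real (Suc l) \<le> 1 / real (Suc N)"
      using that by (auto simp: field_simps)
    ultimately show ?thesis using z(2)[of k] z(2)[of l] by simp
  qed
  have "Cauchy z"
  proof (rule CauchyI)
    fix e :: real assume e: "e > 0"
    then have "\<sigma> / 4 * e\<^sup>2 > 0" using sigma_pos by simp
    then obtain N where N: "1 / real (Suc N) < \<sigma> / 4 * e\<^sup>2"
      using nat_approx_posE by metis
    have "norm (z k - z l) < e" if "k \<ge> N" "l \<ge> N" for k l
    proof -
      have "\<sigma> / 4 * (norm (z k - z l))\<^sup>2 < \<sigma> / 4 * e\<^sup>2"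
        using gap[OF that] N by linarith
      then have "(norm (z k - z l))\<^sup>2 < e\<^sup>2" using sigma_pos by simp
      then show ?thesis using e by (simp add: power_less_imp_less_base)
    qed
    then show "\<exists>N. \<forall>k\<ge>N. \<forall>l\<ge>N. norm (z k - z l) < e" by blast
  qed
  then obtain m where m: "z \<longlonglongrightarrow> m" using Cauchy_convergent_iff convergent_def by blast
  have "(\<lambda>k. \<mu> + 1 / real (Suc k) + \<xi> (z k)) \<longlonglongrightarrow> \<mu> + 0 + \<xi> m"
    by (intro tendsto_intros m LIMSEQ_Suc[OF lim_1_over_n])
  moreover have "r (z k) \<le> \<mu> + 1 / real (Suc k) + \<xi> (z k)" for k
    using z(2)[of k] by (simp add: g_def)
  note closed = r_closed[OF z(1) m this calculation]
  have "r m - \<xi> m \<le> r x - \<xi> x" if "x \<in> D" for x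
    using closed(2) mu_le[OF that] by (simp add: g_def)
  with closed(1) show ?thesis by blast
qed

lemma mirror_map_minimizes:
  fixes \<xi> :: "'x \<Rightarrow>\<^sub>L real"
  shows "mirror_map R \<xi> \<in> D"
    and "x \<in> D \<Longrightarrow> r (mirror_map R \<xi>) - \<xi> (mirror_map R \<xi>) \<le> r x - \<xi> x"
proof -
  let ?f = "\<lambda>x. R x - ereal (\<xi> x)" and ?m = "mirror_map R \<xi>"
  obtain m where m: "m \<in> D" "\<And>x. x \<in> D \<Longrightarrow> r m - \<xi> m \<le> r x - \<xi> x"
    using tilted_attains_minimum by blast
  have "?f m \<le> ?f x" for x
    by (cases "x \<in> D") (use m in \<open>auto simp: R_eq_r R_outside\<close>)
  then have "is_arg_min ?f (\<lambda>_. True) m" by (auto simp: is_arg_min_def not_less)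
  then have "is_arg_min ?f (\<lambda>_. True) ?m"
    unfolding mirror_map_def arg_min_def by (rule someI)
  then have min: "?f ?m \<le> ?f x" for x by (auto simp: is_arg_min_def not_less)
  show "?m \<in> D"
    using min[of m] by (rule contrapos_pp) (auto simp: R_eq_r[OF m(1)] R_outside)
  then show "r ?m - \<xi> ?m \<le> r x - \<xi> x" if "x \<in> D"
    using min[of x] that by (simp add: R_eq_r)
qed

text \<open>
  The point \<open>(1 - z) x + z m\<close> cannot beat the minimizer \<open>m\<close>; strong convexity then gives the claim
  with \<open>\<sigma>\<close> replaced by \<open>z \<sigma>\<close>, and \<open>z\<close> tends to 1.
\<close>
lemma mirror_map_growth:
  fixes \<xi> :: "'x \<Rightarrow>\<^sub>L real"
  assumes "x \<in> D"
  shows "r (mirror_map R \<xi>) - \<xi> (mirror_map R \<xi>) + \<sigma> * (norm (x - mirror_map R \<xi>))\<^sup>2 \<le> r x - \<xi> x"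
proof -
  let ?m = "mirror_map R \<xi>" and ?g = "\<lambda>x. r x - \<xi> x"
  have "z * (\<sigma> * (norm (x - ?m))\<^sup>2) \<le> ?g x - ?g ?m" if z: "0 < z" "z < 1" for z
  proof -
    let ?s = "1 - z"
    let ?y = "?s *\<^sub>R x + (1 - ?s) *\<^sub>R ?m"
    have "?g ?m \<le> ?g ?y"
      by (intro mirror_map_minimizes r_strongly_convex(1) assms) (use z in auto)
    moreover have "?g ?y + \<sigma> * ?s * (1 - ?s) * (norm (x - ?m))\<^sup>2 \<le> ?s * ?g x + (1 - ?s) * ?g ?m"
      by (rule tilted_strongly_convex) (use z assms mirror_map_minimizes in auto)
    ultimately have "?s * (z * (\<sigma> * (norm (x - ?m))\<^sup>2)) \<le> ?s * (?g x - ?g ?m)"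
      by (simp add: algebra_simps)
    then show ?thesis using z by (simp add: mult_le_cancel_left)
  qed
  then have "\<sigma> * (norm (x - ?m))\<^sup>2 \<le> ?g x - ?g ?m"
    by (rule field_le_mult_one_interval)
  then show ?thesis by linarith
qed

text \<open>
  The Fenchel conjugate \<open>R\<^sup>*\<close>, whose supremum is attained at the mirror point.
\<close>
definition conjugate :: "('x \<Rightarrow>\<^sub>L real) \<Rightarrow> real" where
  "conjugate \<xi> = \<xi> (mirror_map R \<xi>) - r (mirror_map R \<xi>)"

lemma fenchel_young_strong:
  fixes \<xi> :: "'x \<Rightarrow>\<^sub>L real"
  assumes "x \<in> D"
  shows "\<xi> x - r x + \<sigma> * (norm (x - mirror_map R \<xi>))\<^sup>2 \<le> conjugate \<xi>"
  using mirror_map_growth[OF assms, of \<xi>] unfolding conjugate_def by linarith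

lemma fenchel_young:
  fixes \<xi> :: "'x \<Rightarrow>\<^sub>L real"
  shows "x \<in> D \<Longrightarrow> \<xi> x - r x \<le> conjugate \<xi>"
  using fenchel_young_strong[of x \<xi>] sigma_pos
  by (smt (verit) mult_nonneg_nonneg zero_le_power2)

text \<open>
  Together with the next lemma: the mirror point is the gradient of \<open>R\<^sup>*\<close>.
\<close>
lemma conjugate_convex:
  fixes \<xi> \<xi>' :: "'x \<Rightarrow>\<^sub>L real"
  shows "conjugate \<xi> + (\<xi>' - \<xi>) (mirror_map R \<xi>) \<le> conjugate \<xi>'"
  using fenchel_young[OF mirror_map_minimizes(1), of \<xi>' \<xi>]
  by (simp add: conjugate_def blinfun.diff_left)

text \<open>
  The strong Fenchel-Young inequality loses \<open>\<sigma> d\<^sup>2\<close> when the mirror point moves by \<open>d\<close>, while the increment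
  \<open>\<xi>' - \<xi>\<close> gains at most \<open>K d\<close>; the maximum of \<open>K d - \<sigma> d\<^sup>2\<close> is \<open>K\<^sup>2 / (4 \<sigma>)\<close>. The constant
  \<open>K\<close> is a parameter, so that a block step can use the norm of \<open>A\<^sub>J\<close>
  rather than that of the whole operator.
\<close>
lemma conjugate_smooth:
  fixes \<xi> \<xi>' :: "'x \<Rightarrow>\<^sub>L real"
  assumes "\<And>h. \<bar>(\<xi>' - \<xi>) h\<bar> \<le> K * norm h"
  shows "conjugate \<xi>' \<le> conjugate \<xi> + (\<xi>' - \<xi>) (mirror_map R \<xi>) + K\<^sup>2 / (4 * \<sigma>)"
proof -
  let ?x = "mirror_map R \<xi>" and ?x' = "mirror_map R \<xi>'"
  define d where "d = norm (?x' - ?x)"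
  have "conjugate \<xi>' - conjugate \<xi> \<le> (\<xi>' - \<xi>) ?x' - \<sigma> * d\<^sup>2"
    using fenchel_young_strong[OF mirror_map_minimizes(1), of \<xi> \<xi>']
    by (simp add: conjugate_def d_def blinfun.diff_left)
  moreover have "(\<xi>' - \<xi>) ?x' = (\<xi>' - \<xi>) ?x + (\<xi>' - \<xi>) (?x' - ?x)"
    by (simp add: blinfun.diff_right)
  moreover have "(\<xi>' - \<xi>) (?x' - ?x) \<le> K * d"
    using assms[of "?x' - ?x"] by (simp add: d_def)
  moreover have "K * d - \<sigma> * d\<^sup>2 = K\<^sup>2 / (4 * \<sigma>) - \<sigma> * (d - K / (2 * \<sigma>))\<^sup>2"
    using sigma_pos by (simp add: field_simps power2_eq_square)
  moreover have "0 \<le> \<sigma> * (d - K / (2 * \<sigma>))\<^sup>2" using sigma_pos by simp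
  ultimately show ?thesis by linarith
qed

lemma subgradient_in_domain:
  fixes \<xi> :: "'x \<Rightarrow>\<^sub>L real"
  assumes "\<xi> \<in> subdifferential R x"
  shows "x \<in> D"
proof -
  obtain z where "z \<in> D" using D_nonempty by auto
  moreover have "R x + ereal (\<xi> (z - x)) \<le> R z"
    using assms by (simp add: subdifferential_def)
  ultimately show ?thesis by (cases "x \<in> D") (auto simp: R_eq_r R_outside)
qed

lemma conjugate_at_subgradient:
  fixes \<xi> :: "'x \<Rightarrow>\<^sub>L real"
  assumes "\<xi> \<in> subdifferential R x"
  shows "conjugate \<xi> = \<xi> x - r x"
proof (rule antisym)
  note x = subgradient_in_domain[OF assms]
  show "\<xi> x - r x \<le> conjugate \<xi>" by (rule fenchel_young[OF x])
  have "R x + ereal (\<xi> (mirror_map R \<xi> - x)) \<le> R (mirror_map R \<xi>)"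
    using assms by (simp add: subdifferential_def)
  then show "conjugate \<xi> \<le> \<xi> x - r x"
    by (simp add: conjugate_def R_eq_r[OF x] R_eq_r[OF mirror_map_minimizes(1)] blinfun.diff_right)
qed

end

section \<open>Blocks and batches\<close>

lemma block_adjoint_apply: "block_adjoint A J v x = (\<Sum>i\<in>J. v i \<bullet> A i x)"
  by (simp add: block_adjoint_def blinfun.sum_left)

lemma abs_sum_inner_le_L2_set:
  "\<bar>\<Sum>i\<in>J. v i \<bullet> w i\<bar> \<le> L2_set (\<lambda>i. norm (v i)) J * L2_set (\<lambda>i. norm (w i)) J"
proof -
  have "\<bar>\<Sum>i\<in>J. v i \<bullet> w i\<bar> \<le> (\<Sum>i\<in>J. \<bar>norm (v i)\<bar> * \<bar>norm (w i)\<bar>)"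
    by (rule order_trans[OF sum_abs]) (auto intro!: sum_mono Cauchy_Schwarz_ineq2)
  also have "\<dots> \<le> L2_set (\<lambda>i. norm (v i)) J * L2_set (\<lambda>i. norm (w i)) J"
    by (rule L2_set_mult_ineq)
  finally show ?thesis .
qed

lemma L2_set_le_block_norm:
  fixes A :: "nat \<Rightarrow> 'x::real_normed_vector \<Rightarrow>\<^sub>L 'h::real_normed_vector"
  shows "L2_set (\<lambda>i. norm (A i x)) J \<le> block_norm A J * norm x"
proof (cases "x = 0")
  case False
  have "L2_set (\<lambda>i. norm (A i z)) J / norm z \<le> (\<Sum>i\<in>J. norm (A i))" for z
  proof (cases "z = 0")
    case False
    have "L2_set (\<lambda>i. norm (A i z)) J \<le> (\<Sum>i\<in>J. norm (A i z))"
      by (rule L2_set_le_sum) auto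
    also have "\<dots> \<le> (\<Sum>i\<in>J. norm (A i)) * norm z"
      by (simp add: sum_distrib_right sum_mono norm_blinfun)
    finally show ?thesis using False by (simp add: pos_divide_le_eq)
  qed (simp add: sum_nonneg)
  then have "bdd_above (range (\<lambda>z. L2_set (\<lambda>i. norm (A i z)) J / norm z))"
    by (intro bdd_aboveI2)
  then have "L2_set (\<lambda>i. norm (A i x)) J / norm x \<le> block_norm A J"
    unfolding block_norm_def by (rule cSUP_upper[rotated]) simp
  then show ?thesis using False by (simp add: pos_divide_le_eq)
qed (auto simp: L2_set_0')

lemma finite_batches: "finite (batches p b)"
  unfolding batches_def by (rule finite_subset[of _ "Pow {1..p}"]) auto

lemma card_batches: "card (batches p b) = p choose b"
  unfolding batches_def using n_subsets[of "{1..p}" b] by simp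

lemma batches_nonempty: "b \<le> p \<Longrightarrow> batches p b \<noteq> {}"
  using card_batches[of p b] binomial_eq_0_iff[of p b] by fastforce

text \<open>
  Each index lies in the fraction \<open>b/p\<close> of all batches; stated without division.
\<close>
lemma card_batches_containing:
  assumes "1 \<le> b" "b \<le> p" "i \<in> {1..p}"
  shows "real p * real (card {J\<in>batches p b. i \<in> J}) = real b * real (card (batches p b))"
proof -
  have without: "{J\<in>batches p b. i \<notin> J} = {J. J \<subseteq> {1..p} - {i} \<and> card J = b}"
    by (auto simp: batches_def)
  have "card (batches p b) = card {J\<in>batches p b. i \<in> J} + card {J\<in>batches p b. i \<notin> J}"
    by (subst card_Un_disjoint[symmetric]) (auto simp: finite_batches intro: arg_cong[where f = card])
  also have "card {J\<in>batches p b. i \<notin> J} = (p - 1) choose b"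
    unfolding without using n_subsets[of "{1..p} - {i}" b] assms(3) by simp
  finally have "p choose b = card {J\<in>batches p b. i \<in> J} + ((p - 1) choose b)"
    by (simp add: card_batches)
  moreover have "p choose b = ((p - 1) choose (b - 1)) + ((p - 1) choose b)"
    using assms binomial_eq_0_iff by (subst choose_reduce_nat) auto
  ultimately have "card {J\<in>batches p b. i \<in> J} = (p - 1) choose (b - 1)" by simp
  moreover have "b * (p choose b) = p * ((p - 1) choose (b - 1))"
    using assms by (intro times_binomial_minus1_eq) auto
  ultimately show ?thesis
    unfolding card_batches by (metis of_nat_mult)
qed

lemma exists_batch_containing:
  assumes "1 \<le> b" "b \<le> p" "i \<in> {1..p}"
  obtains J where "J \<in> batches p b" "i \<in> J"
proof -
  have "real b * real (card (batches p b)) > 0"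
    using assms batches_nonempty[of b p] finite_batches[of p b] by (simp add: card_gt_0_iff)
  then have "{J\<in>batches p b. i \<in> J} \<noteq> {}"
    using card_batches_containing[OF assms] by (metis card.empty mult_zero_right of_nat_0 less_irrefl)
  then show ?thesis using that by auto
qed

lemma average_over_batches:
  fixes a :: "nat \<Rightarrow> real"
  assumes "1 \<le> b" "b \<le> p"
  shows "(\<Sum>J\<in>batches p b. \<Sum>i\<in>J. a i) / card (batches p b) = real b / real p * (\<Sum>i\<in>{1..p}. a i)"
proof -
  let ?B = "batches p b"
  have "(\<Sum>J\<in>?B. \<Sum>i\<in>J. a i) = (\<Sum>J\<in>?B. \<Sum>i\<in>{1..p}. if i \<in> J then a i else 0)"
  proof (rule sum.cong[OF refl])
    fix J assume "J \<in> ?B"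
    then have "{i \<in> {1..p}. i \<in> J} = J" by (auto simp: batches_def)
    then show "(\<Sum>i\<in>J. a i) = (\<Sum>i\<in>{1..p}. if i \<in> J then a i else 0)"
      using sum.inter_filter[of "{1..p}" a "\<lambda>i. i \<in> J"] by simp
  qed
  also have "\<dots> = (\<Sum>i\<in>{1..p}. \<Sum>J\<in>?B. if i \<in> J then a i else 0)" by (rule sum.swap)
  also have "\<dots> = (\<Sum>i\<in>{1..p}. real (card {J\<in>?B. i \<in> J}) * a i)"
    by (intro sum.cong refl) (simp flip: sum.inter_filter add: finite_batches)
  also have "\<dots> = (\<Sum>i\<in>{1..p}. real b / real p * real (card ?B) * a i)"
  proof (rule sum.cong[OF refl])
    fix i assume i: "i \<in> {1..p}"
    then have "real (card {J\<in>?B. i \<in> J}) = real b / real p * real (card ?B)"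
      using card_batches_containing[OF assms i] assms by (simp add: field_simps)
    then show "real (card {J\<in>?B. i \<in> J}) * a i = real b / real p * real (card ?B) * a i" by simp
  qed
  also have "\<dots> = real b / real p * real (card ?B) * (\<Sum>i\<in>{1..p}. a i)"
    by (simp add: sum_distrib_left)
  finally show ?thesis
    using batches_nonempty[OF assms(2)] finite_batches[of p b] by simp
qed

section \<open>Block coordinate descent in multiplier space\<close>

text \<open>
  The weight \<open>w i\<close> is the common step-size of all batches that contain \<open>i\<close>. Such weights exist
  because the step-size is constant unless the batches are singletons, and they are what makes
  the cross term in \<open>weighted_dist_step\<close> below independent of the step-size.
\<close>
locale block_descent = strongly_convex_functional R \<sigma>
  for R :: "'x::banach \<Rightarrow> ereal" and \<sigma> :: real +
  fixes p b :: nat and A :: "nat \<Rightarrow> 'x \<Rightarrow>\<^sub>L 'h::real_inner"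
    and yd :: "nat \<Rightarrow> 'h" and t :: "nat set \<Rightarrow> real" and w :: "nat \<Rightarrow> real" and \<kappa> :: real
  assumes b: "1 \<le> b" "b \<le> p"
    and t_pos: "\<And>J. J \<in> batches p b \<Longrightarrow> t J > 0"
    and t_le: "\<And>J. J \<in> batches p b \<Longrightarrow> t J * (block_norm A J)\<^sup>2 \<le> \<kappa>"
    and kappa: "\<kappa> < 4 * \<sigma>"
    and w_eq: "\<And>J i. J \<in> batches p b \<Longrightarrow> i \<in> J \<Longrightarrow> w i = t J"
begin

abbreviation dual_of :: "(nat \<Rightarrow> 'h) \<Rightarrow> 'x \<Rightarrow>\<^sub>L real" where
  "dual_of \<equiv> block_adjoint A {1..p}"

abbreviation primal_of :: "(nat \<Rightarrow> 'h) \<Rightarrow> 'x" where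
  "primal_of \<eta> \<equiv> mirror_map R (dual_of \<eta>)"

definition residual :: "(nat \<Rightarrow> 'h) \<Rightarrow> nat \<Rightarrow> 'h" where
  "residual \<eta> i = A i (primal_of \<eta>) - yd i"

definition dual_objective :: "(nat \<Rightarrow> 'h) \<Rightarrow> real" where
  "dual_objective \<eta> = conjugate (dual_of \<eta>) - (\<Sum>i\<in>{1..p}. \<eta> i \<bullet> yd i)"

definition descent_factor :: real where "descent_factor = 1 - \<kappa> / (4 * \<sigma>)"

text \<open>
  One step of the method in multiplier space; only the block \<open>J\<close> moves.
\<close>
definition step :: "nat set \<Rightarrow> (nat \<Rightarrow> 'h) \<Rightarrow> nat \<Rightarrow> 'h" where
  "step J \<eta> i = \<eta> i - (if i \<in> J then t J *\<^sub>R residual \<eta> i else 0)"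

primrec multiplier :: "(nat \<Rightarrow> nat set) \<Rightarrow> nat \<Rightarrow> nat \<Rightarrow> 'h" where
  "multiplier u 0 = (\<lambda>_. 0)"
| "multiplier u (Suc n) = step (u n) (multiplier u n)"

definition weighted_dist :: "(nat \<Rightarrow> 'h) \<Rightarrow> (nat \<Rightarrow> 'h) \<Rightarrow> real" where
  "weighted_dist \<eta> \<mu> = (\<Sum>i\<in>{1..p}. (norm (\<eta> i - \<mu> i))\<^sup>2 / w i)"

lemma batch_subset: "J \<in> batches p b \<Longrightarrow> J \<subseteq> {1..p}"
  by (simp add: batches_def)

lemma w_pos: "i \<in> {1..p} \<Longrightarrow> w i > 0"
  using exists_batch_containing[OF b] t_pos w_eq by metis

lemma kappa_nonneg: "0 \<le> \<kappa>"
proof -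
  obtain J where "J \<in> batches p b" using batches_nonempty[OF b(2)] by auto
  then show ?thesis using t_pos[of J] t_le[of J]
    by (meson less_imp_le mult_nonneg_nonneg order_trans zero_le_power2)
qed

lemma descent_factor_bounds: "0 < descent_factor" "descent_factor \<le> 1"
  using kappa kappa_nonneg sigma_pos by (auto simp: descent_factor_def)

lemma sum_step:
  assumes "J \<subseteq> {1..p}"
  shows "(\<Sum>i\<in>{1..p}. step J \<eta> i \<bullet> z i)
    = (\<Sum>i\<in>{1..p}. \<eta> i \<bullet> z i) - t J * (\<Sum>i\<in>J. residual \<eta> i \<bullet> z i)"
proof -
  have "(\<Sum>i\<in>{1..p}. (if i \<in> J then t J *\<^sub>R residual \<eta> i else 0) \<bullet> z i)
      = (\<Sum>i\<in>{1..p}. if i \<in> J then t J * (residual \<eta> i \<bullet> z i) else 0)"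
    by (intro sum.cong) auto
  also have "\<dots> = (\<Sum>i\<in>{i\<in>{1..p}. i \<in> J}. t J * (residual \<eta> i \<bullet> z i))"
    by (rule sum.inter_filter[symmetric]) simp
  also have "{i\<in>{1..p}. i \<in> J} = J" using assms by auto
  finally show ?thesis
    by (simp add: step_def inner_diff_left sum_subtractf sum_distrib_left)
qed

lemma dual_of_step:
  assumes "J \<subseteq> {1..p}"
  shows "dual_of (step J \<eta>) = dual_of \<eta> - t J *\<^sub>R block_adjoint A J (residual \<eta>)"
  by (rule blinfun_eqI)
    (simp add: block_adjoint_apply sum_step[OF assms] blinfun.diff_left blinfun.scaleR_left
        del: One_nat_def)

lemma smd_dual_eq_multiplier:
  assumes "\<And>k. u k \<in> batches p b"
  shows "smd_dual R A yd t u n = dual_of (multiplier u n)"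
proof (induction n)
  case 0
  show ?case by (rule blinfun_eqI) (simp add: block_adjoint_apply)
next
  case (Suc n)
  have "residual (multiplier u n) = (\<lambda>i. A i (primal_of (multiplier u n)) - yd i)"
    by (simp add: residual_def fun_eq_iff)
  with Suc show ?case using dual_of_step[OF batch_subset[OF assms], of n "multiplier u n"] by simp
qed

lemma multiplier_prefix:
  "(\<And>k. k < n \<Longrightarrow> u k = v k) \<Longrightarrow> multiplier u n = multiplier v n"
  by (induction n) auto

lemma dual_objective_convex:
  "dual_objective \<eta> + (\<Sum>i\<in>{1..p}. (\<mu> i - \<eta> i) \<bullet> residual \<eta> i) \<le> dual_objective \<mu>"
proof -
  have "(\<Sum>i\<in>{1..p}. (\<mu> i - \<eta> i) \<bullet> residual \<eta> i)
      = (dual_of \<mu> - dual_of \<eta>) (primal_of \<eta>)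
        - ((\<Sum>i\<in>{1..p}. \<mu> i \<bullet> yd i) - (\<Sum>i\<in>{1..p}. \<eta> i \<bullet> yd i))"
    by (simp add: residual_def block_adjoint_apply blinfun.diff_left inner_diff_left
        inner_diff_right sum_subtractf)
  then show ?thesis
    using conjugate_convex[of "dual_of \<eta>" "dual_of \<mu>"] by (simp add: dual_objective_def)
qed

text \<open>
  Smoothness of \<open>R\<^sup>*\<close> with the constant \<open>K = t\<^sub>J \<parallel>residual on J\<parallel> \<parallel>A\<^sub>J\<parallel>\<close>. The linear part of the
  change is \<open>- t\<^sub>J S\<close>, where \<open>S\<close> is the squared norm of the residual on \<open>J\<close>, and the quadratic part is at most
  \<open>t\<^sub>J S\<close> times \<open>\<kappa> / (4 \<sigma>)\<close>.
\<close>
lemma dual_objective_step: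
  assumes J: "J \<in> batches p b"
  shows "dual_objective (step J \<eta>) + descent_factor * (t J * (\<Sum>i\<in>J. (norm (residual \<eta> i))\<^sup>2))
    \<le> dual_objective \<eta>"
proof -
  note sub = batch_subset[OF J]
  define S where "S = (\<Sum>i\<in>J. (norm (residual \<eta> i))\<^sup>2)"
  have S: "S \<ge> 0" "(L2_set (\<lambda>i. norm (residual \<eta> i)) J)\<^sup>2 = S"
    by (auto simp: S_def L2_set_def sum_nonneg)
  define K where "K = t J * L2_set (\<lambda>i. norm (residual \<eta> i)) J * block_norm A J"
  have diff: "dual_of (step J \<eta>) - dual_of \<eta> = - (t J *\<^sub>R block_adjoint A J (residual \<eta>))"
    by (simp add: dual_of_step[OF sub] del: One_nat_def)
  have bound: "\<bar>(dual_of (step J \<eta>) - dual_of \<eta>) h\<bar> \<le> K * norm h" for h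
  proof -
    have "\<bar>(dual_of (step J \<eta>) - dual_of \<eta>) h\<bar> = t J * \<bar>\<Sum>i\<in>J. residual \<eta> i \<bullet> A i h\<bar>"
      using t_pos[OF J]
      by (simp add: diff blinfun.minus_left blinfun.scaleR_left block_adjoint_apply abs_mult
          del: One_nat_def)
    also have "\<dots> \<le> t J * (L2_set (\<lambda>i. norm (residual \<eta> i)) J * L2_set (\<lambda>i. norm (A i h)) J)"
      using t_pos[OF J] by (intro mult_left_mono abs_sum_inner_le_L2_set) auto
    also have "\<dots> \<le> t J * (L2_set (\<lambda>i. norm (residual \<eta> i)) J * (block_norm A J * norm h))"
      using t_pos[OF J] by (intro mult_left_mono L2_set_le_block_norm) auto
    finally show ?thesis by (simp add: K_def mult_ac)
  qed
  have "K\<^sup>2 = t J * (t J * (block_norm A J)\<^sup>2) * S"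
    unfolding S(2)[symmetric] by (simp add: K_def power_mult_distrib power2_eq_square)
  also have "\<dots> \<le> t J * \<kappa> * S"
    using t_pos[OF J] t_le[OF J] S(1) by (intro mult_right_mono mult_left_mono) auto
  finally have "K\<^sup>2 / (4 * \<sigma>) \<le> t J * \<kappa> * S / (4 * \<sigma>)"
    using sigma_pos by (simp add: divide_right_mono)
  moreover have "t J * \<kappa> * S / (4 * \<sigma>) = t J * S - descent_factor * (t J * S)"
    by (simp add: descent_factor_def left_diff_distrib)
  moreover have "(dual_of (step J \<eta>) - dual_of \<eta>) (primal_of \<eta>)
      = - t J * (\<Sum>i\<in>J. residual \<eta> i \<bullet> A i (primal_of \<eta>))"
    by (simp add: diff blinfun.minus_left blinfun.scaleR_left block_adjoint_apply del: One_nat_def)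
  moreover have "S = (\<Sum>i\<in>J. residual \<eta> i \<bullet> A i (primal_of \<eta>)) - (\<Sum>i\<in>J. residual \<eta> i \<bullet> yd i)"
    unfolding S_def power2_norm_eq_inner
    by (simp add: sum_subtractf[symmetric] inner_diff_right[symmetric] residual_def)
  then have "t J * S = t J * (\<Sum>i\<in>J. residual \<eta> i \<bullet> A i (primal_of \<eta>))
      - t J * (\<Sum>i\<in>J. residual \<eta> i \<bullet> yd i)"
    by (simp only: right_diff_distrib)
  ultimately show ?thesis
    using conjugate_smooth[OF bound]
    unfolding dual_objective_def sum_step[OF sub] S_def[symmetric] mult_minus_left
    by linarith
qed

lemma weighted_dist_step:
  assumes J: "J \<in> batches p b"
  shows "weighted_dist (step J \<eta>) \<mu> = weighted_dist \<eta> \<mu>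
    - 2 * (\<Sum>i\<in>J. (\<eta> i - \<mu> i) \<bullet> residual \<eta> i) + t J * (\<Sum>i\<in>J. (norm (residual \<eta> i))\<^sup>2)"
proof -
  let ?c = "\<lambda>i. t J * (norm (residual \<eta> i))\<^sup>2 - 2 * ((\<eta> i - \<mu> i) \<bullet> residual \<eta> i)"
  have "(norm (step J \<eta> i - \<mu> i))\<^sup>2 / w i = (norm (\<eta> i - \<mu> i))\<^sup>2 / w i + (if i \<in> J then ?c i else 0)"
    for i
  proof (cases "i \<in> J")
    case True
    have "step J \<eta> i - \<mu> i = (\<eta> i - \<mu> i) - t J *\<^sub>R residual \<eta> i"
      using True by (simp add: step_def)
    have "(norm (step J \<eta> i - \<mu> i))\<^sup>2
        = (norm (\<eta> i - \<mu> i))\<^sup>2 - 2 * (t J * ((\<eta> i - \<mu> i) \<bullet> residual \<eta> i))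
          + (t J)\<^sup>2 * (norm (residual \<eta> i))\<^sup>2"
      unfolding \<open>step J \<eta> i - \<mu> i = _\<close>
      using dot_norm_neg[of "\<eta> i - \<mu> i" "t J *\<^sub>R residual \<eta> i"]
      by (simp add: power_mult_distrib)
    then show ?thesis
      using True w_eq[OF J True] t_pos[OF J] by (simp add: field_simps power2_eq_square)
  qed (simp add: step_def)
  then have "weighted_dist (step J \<eta>) \<mu>
      = weighted_dist \<eta> \<mu> + (\<Sum>i\<in>{1..p}. if i \<in> J then ?c i else 0)"
    by (simp add: weighted_dist_def sum.distrib)
  also have "(\<Sum>i\<in>{1..p}. if i \<in> J then ?c i else 0) = (\<Sum>i\<in>{i\<in>{1..p}. i \<in> J}. ?c i)"
    by (rule sum.inter_filter[symmetric]) simp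
  also have "{i\<in>{1..p}. i \<in> J} = J" using batch_subset[OF J] by auto
  finally show ?thesis by (simp add: sum_subtractf sum_distrib_left)
qed

text \<open>
  The coefficient \<open>1 / descent_factor\<close> of the objective is chosen so that its decrease cancels the
  quadratic term \<open>t\<^sub>J \<parallel>residual on J\<parallel>\<^sup>2\<close> in the change of the distance.
\<close>
lemma potential_step:
  assumes J: "J \<in> batches p b"
  shows "weighted_dist (step J \<eta>) \<mu> + dual_objective (step J \<eta>) / descent_factor
    \<le> weighted_dist \<eta> \<mu> + dual_objective \<eta> / descent_factor
      - 2 * (\<Sum>i\<in>J. (\<eta> i - \<mu> i) \<bullet> residual \<eta> i)"
proof -
  have "(dual_objective (step J \<eta>)
      + descent_factor * (t J * (\<Sum>i\<in>J. (norm (residual \<eta> i))\<^sup>2))) / descent_factor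
      \<le> dual_objective \<eta> / descent_factor"
    using dual_objective_step[OF J] descent_factor_bounds by (intro divide_right_mono) auto
  then show ?thesis
    unfolding weighted_dist_step[OF J] using descent_factor_bounds
    by (simp add: add_divide_distrib)
qed

lemma dual_objective_step_le:
  assumes J: "J \<in> batches p b"
  shows "dual_objective (step J \<eta>) \<le> dual_objective \<eta>"
proof -
  have "0 \<le> descent_factor * (t J * (\<Sum>i\<in>J. (norm (residual \<eta> i))\<^sup>2))"
    using descent_factor_bounds t_pos[OF J] by (simp add: sum_nonneg)
  then show ?thesis using dual_objective_step[OF J, of \<eta>] by linarith
qed

end

section \<open>Expectations along random selections\<close>

locale selection_process = prob_space M for M :: "'w measure" +
  fixes p b :: nat and I :: "nat \<Rightarrow> 'w \<Rightarrow> nat set"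
  assumes selections: "uniform_selections p b M I"
begin

abbreviation draws :: "'w \<Rightarrow> nat \<Rightarrow> nat set" where "draws \<omega> k \<equiv> I k \<omega>"

text \<open>
  The iterate with index \<open>n\<close> is a function of the first \<open>n\<close> batches. Integrability and independence
  of the next batch are derived from this property alone.
\<close>
definition depends_on_prefix :: "nat \<Rightarrow> ((nat \<Rightarrow> nat set) \<Rightarrow> 'a) \<Rightarrow> bool" where
  "depends_on_prefix n \<phi> \<longleftrightarrow> (\<forall>u v. (\<forall>k<n. u k = v k) \<longrightarrow> \<phi> u = \<phi> v)"

lemma I_indep: "indep_vars (\<lambda>_. count_space (batches p b)) I UNIV"
  and I_distr: "distr M (count_space (batches p b)) (I n) = uniform_count_measure (batches p b)"
  using selections by (auto simp: uniform_selections_def)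

lemma I_measurable: "I k \<in> measurable M (count_space (batches p b))"
  using I_indep by (simp add: indep_vars_def)

lemma I_in_batches: "\<omega> \<in> space M \<Longrightarrow> I k \<omega> \<in> batches p b"
  using measurable_space[OF I_measurable] by simp

lemma prefix_measurable:
  "(\<lambda>\<omega>. restrict (draws \<omega>) {..<n}) \<in> measurable M (Pi\<^sub>M {..<n} (\<lambda>_. count_space (batches p b)))"
  by (intro measurable_restrict I_measurable)

text \<open>
  A finite product of finite discrete spaces is discrete, so every function on it is measurable.
\<close>
lemma prefix_function_measurable:
  "(\<phi> :: (nat \<Rightarrow> nat set) \<Rightarrow> real)
    \<in> borel_measurable (Pi\<^sub>M {..<n} (\<lambda>_. count_space (batches p b)))"
  by (subst count_space_PiM_finite) (auto intro: countable_finite finite_batches)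

lemma restrict_prefix:
  "depends_on_prefix n \<phi> \<Longrightarrow> \<phi> (restrict u {..<n}) = \<phi> u"
  unfolding depends_on_prefix_def by (metis lessThan_iff restrict_apply')

lemma integrable_prefix:
  fixes \<phi> :: "(nat \<Rightarrow> nat set) \<Rightarrow> real"
  assumes "depends_on_prefix n \<phi>"
  shows "integrable M (\<lambda>\<omega>. \<phi> (draws \<omega>))"
proof -
  let ?P = "PiE {..<n} (\<lambda>_. batches p b)"
  have fin: "finite ?P" by (intro finite_PiE) (auto simp: finite_batches)
  have "(\<lambda>\<omega>. \<phi> (restrict (draws \<omega>) {..<n})) \<in> borel_measurable M"
    by (rule measurable_compose[OF prefix_measurable prefix_function_measurable])
  moreover have "norm (\<phi> (restrict (draws \<omega>) {..<n})) \<le> Max ((\<lambda>u. norm (\<phi> u)) ` ?P)"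
    if "\<omega> \<in> space M" for \<omega>
    using that by (intro Max_ge finite_imageI fin imageI) (auto intro: I_in_batches)
  ultimately have "integrable M (\<lambda>\<omega>. \<phi> (restrict (draws \<omega>) {..<n}))"
    by (intro integrable_const_bound[where B = "Max ((\<lambda>u. norm (\<phi> u)) ` ?P)"]) auto
  then show ?thesis by (simp add: restrict_prefix[OF assms])
qed

text \<open>
  The conditional expectation of a quantity given the first \<open>n\<close> selections averages it over the
  next batch. The proof splits \<open>\<psi>\<close> according to the value of that batch; each summand is a product
  of two independent factors.
\<close>
lemma expectation_next_selection:
  fixes \<psi> :: "(nat \<Rightarrow> nat set) \<Rightarrow> nat set \<Rightarrow> real"
  assumes "\<And>J. depends_on_prefix n (\<lambda>u. \<psi> u J)"
  shows "expectation (\<lambda>\<omega>. \<psi> (draws \<omega>) (I n \<omega>))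
    = expectation (\<lambda>\<omega>. (\<Sum>J\<in>batches p b. \<psi> (draws \<omega>) J) / card (batches p b))"
proof -
  let ?B = "batches p b"
  have int: "integrable M (\<lambda>\<omega>. \<psi> (draws \<omega>) J)" for J
    using integrable_prefix[OF assms] .
  have hit: "integrable M (\<lambda>\<omega>. indicator {J} (I n \<omega>) :: real)"
    "expectation (\<lambda>\<omega>. indicator {J} (I n \<omega>)) = 1 / card ?B" if J: "J \<in> ?B" for J
  proof -
    have "(\<lambda>\<omega>. indicator {J} (I n \<omega>) :: real) \<in> borel_measurable M"
      by (rule measurable_compose[OF I_measurable]) simp
    then show "integrable M (\<lambda>\<omega>. indicator {J} (I n \<omega>) :: real)"
      by (intro integrable_const_bound[where B = 1]) (auto simp: indicator_def)
    have "expectation (\<lambda>\<omega>. indicator {J} (I n \<omega>))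
        = integral\<^sup>L (distr M (count_space ?B) (I n)) (indicator {J} :: _ \<Rightarrow> real)"
      by (rule integral_distr[OF I_measurable, symmetric]) simp
    also have "\<dots> = (\<Sum>K\<in>?B. indicator {J} K) / card ?B"
      unfolding I_distr by (rule integral_uniform_count_measure[OF finite_batches])
    also have "(\<Sum>K\<in>?B. indicator {J} K) = (1 :: real)"
      using J finite_batches by (simp add: indicator_def sum.delta')
    finally show "expectation (\<lambda>\<omega>. indicator {J} (I n \<omega>)) = 1 / card ?B" .
  qed
  have indep: "indep_var borel (\<lambda>\<omega>. \<psi> (draws \<omega>) J) borel (\<lambda>\<omega>. indicator {J} (I n \<omega>) :: real)" for J
  proof -
    let ?N = "\<lambda>_::nat. count_space ?B"
    have "indep_var (Pi\<^sub>M {..<n} ?N) (\<lambda>\<omega>. restrict (draws \<omega>) {..<n})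
        (Pi\<^sub>M {n} ?N) (\<lambda>\<omega>. restrict (draws \<omega>) {n})"
      by (rule indep_var_restrict[OF I_indep]) auto
    moreover have "(\<lambda>f. indicator {J} (f n) :: real) \<in> borel_measurable (Pi\<^sub>M {n} ?N)"
      by (rule measurable_compose[OF measurable_component_singleton[of n]]) auto
    ultimately have "indep_var borel ((\<lambda>u. \<psi> u J) \<circ> (\<lambda>\<omega>. restrict (draws \<omega>) {..<n}))
        borel ((\<lambda>f. indicator {J} (f n) :: real) \<circ> (\<lambda>\<omega>. restrict (draws \<omega>) {n}))"
      by (rule indep_var_compose[OF _ prefix_function_measurable])
    then show ?thesis by (simp add: o_def restrict_prefix[OF assms])
  qed
  have "expectation (\<lambda>\<omega>. \<psi> (draws \<omega>) (I n \<omega>))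
      = expectation (\<lambda>\<omega>. \<Sum>J\<in>?B. \<psi> (draws \<omega>) J * indicator {J} (I n \<omega>))"
  proof (rule Bochner_Integration.integral_cong[OF refl])
    fix \<omega> assume "\<omega> \<in> space M"
    then have "I n \<omega> \<in> ?B" by (rule I_in_batches)
    then show "\<psi> (draws \<omega>) (I n \<omega>) = (\<Sum>J\<in>?B. \<psi> (draws \<omega>) J * indicator {J} (I n \<omega>))"
      using finite_batches by (simp add: indicator_def if_distrib sum.delta cong: if_cong)
  qed
  also have "\<dots> = (\<Sum>J\<in>?B. expectation (\<lambda>\<omega>. \<psi> (draws \<omega>) J * indicator {J} (I n \<omega>)))"
    by (rule Bochner_Integration.integral_sum) (rule indep_var_integrable[OF indep int hit(1)])
  also have "\<dots> = (\<Sum>J\<in>?B. expectation (\<lambda>\<omega>. \<psi> (draws \<omega>) J) * (1 / card ?B))"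
    by (intro sum.cong refl) (simp only: indep_var_lebesgue_integral[OF indep int hit(1)] hit(2))
  also have "\<dots> = expectation (\<lambda>\<omega>. (\<Sum>J\<in>?B. \<psi> (draws \<omega>) J) / card ?B)"
    by (simp add: int Bochner_Integration.integral_sum sum_divide_distrib)
  finally show ?thesis .
qed

end

section \<open>The expected error of the noisy iteration\<close>

locale noisy_descent =
  block_descent R \<sigma> p b A yd t w \<kappa> + selection_process M p b I
  for R :: "'x::banach \<Rightarrow> ereal" and \<sigma> :: real and p b :: nat
    and A :: "nat \<Rightarrow> 'x \<Rightarrow>\<^sub>L 'h::real_inner"
    and yd :: "nat \<Rightarrow> 'h" and t :: "nat set \<Rightarrow> real" and w :: "nat \<Rightarrow> real" and \<kappa> :: real
    and M :: "'w measure" and I :: "nat \<Rightarrow> 'w \<Rightarrow> nat set" +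
  fixes y ldag :: "nat \<Rightarrow> 'h" and xdag :: 'x and \<delta> tmin tmax :: real
  assumes xdag_solves: "solves p A y xdag"
    and source: "block_adjoint A {1..p} ldag \<in> subdifferential R xdag"
    and noise: "L2_set (\<lambda>i. norm (yd i - y i)) {1..p} \<le> \<delta>"
    and steps: "\<And>i. i \<in> {1..p} \<Longrightarrow> tmin \<le> w i" "\<And>i. i \<in> {1..p} \<Longrightarrow> w i \<le> tmax"
    and tmin_pos: "tmin > 0" and tmax_pos: "tmax > 0"
begin

lemma dual_of_xdag: "dual_of \<eta> xdag = (\<Sum>i\<in>{1..p}. \<eta> i \<bullet> y i)"
  unfolding block_adjoint_apply using xdag_solves by (intro sum.cong) (auto simp: solves_def)

definition gap :: "(nat \<Rightarrow> 'h) \<Rightarrow> real" where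
  "gap \<eta> = dual_objective \<eta> - dual_objective ldag"

text \<open>
  The first three terms are the Bregman distance of \<open>R\<close> from the mirror point to \<open>xdag\<close>; the last one
  is the contribution of the noise. The source condition enters through the value of \<open>R\<^sup>*\<close> at
  \<open>A\<^sup>* ldag\<close>.
\<close>
lemma gap_eq:
  "gap \<eta> = conjugate (dual_of \<eta>) - dual_of \<eta> xdag + r xdag
    - (\<Sum>i\<in>{1..p}. (\<eta> i - ldag i) \<bullet> (yd i - y i))"
  unfolding gap_def dual_objective_def conjugate_at_subgradient[OF source] dual_of_xdag
  by (simp add: inner_diff_left inner_diff_right sum_subtractf)

lemma noise_pairing_le:
  "\<bar>\<Sum>i\<in>{1..p}. v i \<bullet> (yd i - y i)\<bar> \<le> L2_set (\<lambda>i. norm (v i)) {1..p} * \<delta>"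
  using abs_sum_inner_le_L2_set noise
  by (rule order_trans[OF _ mult_left_mono]) simp

lemma weighted_dist_lower:
  "(L2_set (\<lambda>i. norm (\<eta> i - \<mu> i)) {1..p})\<^sup>2 / tmax \<le> weighted_dist \<eta> \<mu>"
proof -
  have "(\<Sum>i\<in>{1..p}. (norm (\<eta> i - \<mu> i))\<^sup>2 / tmax) \<le> weighted_dist \<eta> \<mu>"
    unfolding weighted_dist_def
  proof (rule sum_mono)
    fix i assume "i \<in> {1..p}"
    then show "(norm (\<eta> i - \<mu> i))\<^sup>2 / tmax \<le> (norm (\<eta> i - \<mu> i))\<^sup>2 / w i"
      using steps(2) w_pos tmax_pos by (intro divide_left_mono) auto
  qed
  then show ?thesis by (simp add: L2_set_def sum_nonneg sum_divide_distrib)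
qed

lemma weighted_dist_upper:
  "weighted_dist \<eta> \<mu> \<le> (L2_set (\<lambda>i. norm (\<eta> i - \<mu> i)) {1..p})\<^sup>2 / tmin"
proof -
  have "weighted_dist \<eta> \<mu> \<le> (\<Sum>i\<in>{1..p}. (norm (\<eta> i - \<mu> i))\<^sup>2 / tmin)"
    unfolding weighted_dist_def
  proof (rule sum_mono)
    fix i assume "i \<in> {1..p}"
    then show "(norm (\<eta> i - \<mu> i))\<^sup>2 / w i \<le> (norm (\<eta> i - \<mu> i))\<^sup>2 / tmin"
      using steps(1) w_pos tmin_pos by (intro divide_left_mono) auto
  qed
  then show ?thesis by (simp add: L2_set_def sum_nonneg sum_divide_distrib)
qed

text \<open>
  The noise may make the gap negative. Its effect \<open>N \<delta> L\<close>, where \<open>L\<close> is the distance of \<open>\<eta>\<close> from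
  \<open>ldag\<close>, is absorbed by the weighted distance, at the price of the last term.
\<close>
lemma error_le_lyapunov:
  assumes "N \<ge> 0"
  shows "N * \<sigma> * (norm (primal_of \<eta> - xdag))\<^sup>2
    \<le> weighted_dist \<eta> ldag + N * gap \<eta> + (N * \<delta>)\<^sup>2 * tmax / 4"
proof -
  let ?e = "\<Sum>i\<in>{1..p}. (\<eta> i - ldag i) \<bullet> (yd i - y i)"
  define L where "L = L2_set (\<lambda>i. norm (\<eta> i - ldag i)) {1..p}"
  have "\<sigma> * (norm (primal_of \<eta> - xdag))\<^sup>2 \<le> gap \<eta> + ?e"
    using fenchel_young_strong[OF subgradient_in_domain[OF source], of "dual_of \<eta>"]
    by (simp add: gap_eq norm_minus_commute)
  also have "?e \<le> L * \<delta>"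
    using noise_pairing_le[of "\<lambda>i. \<eta> i - ldag i"] by (simp add: L_def)
  finally have "N * (\<sigma> * (norm (primal_of \<eta> - xdag))\<^sup>2) \<le> N * (gap \<eta> + L * \<delta>)"
    using assms by (intro mult_left_mono) auto
  moreover have "L * (N * \<delta>) \<le> L\<^sup>2 / tmax + (N * \<delta>)\<^sup>2 * tmax / 4"
  proof -
    have "L\<^sup>2 / tmax + (N * \<delta>)\<^sup>2 * tmax / 4 - L * (N * \<delta>) = (L - N * \<delta> * tmax / 2)\<^sup>2 / tmax"
      using tmax_pos by (simp add: field_simps power2_eq_square)
    also have "\<dots> \<ge> 0" using tmax_pos by simp
    finally show ?thesis by simp
  qed
  moreover have "L\<^sup>2 / tmax \<le> weighted_dist \<eta> ldag"
    unfolding L_def by (rule weighted_dist_lower)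
  ultimately show ?thesis by (simp add: algebra_simps)
qed

lemma gap_le_pairing: "gap \<eta> \<le> (\<Sum>i\<in>{1..p}. (\<eta> i - ldag i) \<bullet> residual \<eta> i)"
proof -
  have "(\<Sum>i\<in>{1..p}. (ldag i - \<eta> i) \<bullet> residual \<eta> i) = - (\<Sum>i\<in>{1..p}. (\<eta> i - ldag i) \<bullet> residual \<eta> i)"
    by (simp add: inner_diff_left sum_subtractf)
  with dual_objective_convex[of \<eta> ldag] show ?thesis by (simp add: gap_def)
qed

text \<open>
  The initial value \<open>1 / descent_factor\<close> is the coefficient from \<open>potential_step\<close>; every step adds
  twice the probability that a given index is selected.
\<close>
definition gain :: "nat \<Rightarrow> real" where
  "gain n = 1 / descent_factor + 2 * (real b / real p * real n)"

definition lyapunov :: "nat \<Rightarrow> real" where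
  "lyapunov n = expectation (\<lambda>\<omega>. weighted_dist (multiplier (draws \<omega>) n) ldag
     + gain n * gap (multiplier (draws \<omega>) n))"

lemma multiplier_depends_on_prefix:
  "depends_on_prefix n (\<lambda>u. f (multiplier u n))"
  "depends_on_prefix (Suc n) (\<lambda>u. g (multiplier u n) (u n))"
proof -
  show "depends_on_prefix n (\<lambda>u. f (multiplier u n))"
    unfolding depends_on_prefix_def
  proof (intro allI impI)
    fix u v :: "nat \<Rightarrow> nat set" assume "\<forall>k<n. u k = v k"
    then have "multiplier u n = multiplier v n" by (intro multiplier_prefix) auto
    then show "f (multiplier u n) = f (multiplier v n)" by simp
  qed
  show "depends_on_prefix (Suc n) (\<lambda>u. g (multiplier u n) (u n))"
    unfolding depends_on_prefix_def
  proof (intro allI impI)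
    fix u v :: "nat \<Rightarrow> nat set" assume eq: "\<forall>k<Suc n. u k = v k"
    then have "multiplier u n = multiplier v n" by (intro multiplier_prefix) auto
    with eq show "g (multiplier u n) (u n) = g (multiplier v n) (v n)" by simp
  qed
qed

lemma integrable_multiplier:
  fixes f :: "(nat \<Rightarrow> 'h) \<Rightarrow> real"
  shows "integrable M (\<lambda>\<omega>. f (multiplier (draws \<omega>) n))"
  by (rule integrable_prefix[OF multiplier_depends_on_prefix(1)[where f = f]])

text \<open>
  A step changes the expected potential by at most \<open>- 2 (b/p)\<close> times the expected gap. As the objective
  never increases along a path, the same amount can be added back with the new gap in place of the old
  one, which is the growth of \<open>gain\<close>.
\<close>
lemma lyapunov_decreasing: "lyapunov (Suc n) \<le> lyapunov n"
proof -
  let ?\<eta> = "\<lambda>\<omega>. multiplier (draws \<omega>) n"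
  let ?V = "\<lambda>\<omega>. weighted_dist (?\<eta> \<omega>) ldag + gain n * gap (?\<eta> \<omega>)"
  let ?c = "2 * (real b / real p)"
  define s where "s \<eta> J = (\<Sum>i\<in>J. (\<eta> i - ldag i) \<bullet> residual \<eta> i)" for \<eta> J
  have int_s: "integrable M (\<lambda>\<omega>. s (?\<eta> \<omega>) (I n \<omega>))"
    by (rule integrable_prefix[OF multiplier_depends_on_prefix(2)[where g = s]])
  have int_V: "integrable M ?V"
    by (rule integrable_multiplier[where f = "\<lambda>\<eta>. weighted_dist \<eta> ldag + gain n * gap \<eta>"])
  have int_gap: "integrable M (\<lambda>\<omega>. gap (?\<eta> \<omega>))" by (rule integrable_multiplier)
  have average: "expectation (\<lambda>\<omega>. s (?\<eta> \<omega>) (I n \<omega>))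
      = real b / real p * expectation (\<lambda>\<omega>. s (?\<eta> \<omega>) {1..p})"
  proof -
    have "expectation (\<lambda>\<omega>. s (?\<eta> \<omega>) (I n \<omega>))
        = expectation (\<lambda>\<omega>. (\<Sum>J\<in>batches p b. s (?\<eta> \<omega>) J) / card (batches p b))"
      by (rule expectation_next_selection[where \<psi> = "\<lambda>u J. s (multiplier u n) J",
          OF multiplier_depends_on_prefix(1)])
    also have "\<dots> = expectation (\<lambda>\<omega>. real b / real p * s (?\<eta> \<omega>) {1..p})"
      unfolding s_def average_over_batches[OF b] ..
    finally show ?thesis by simp
  qed
  have "expectation (\<lambda>\<omega>. gap (?\<eta> \<omega>)) \<le> expectation (\<lambda>\<omega>. s (?\<eta> \<omega>) {1..p})"
    unfolding s_def
    by (intro integral_mono int_gap gap_le_pairing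
        integrable_multiplier[where f = "\<lambda>\<eta>. \<Sum>i\<in>{1..p}. (\<eta> i - ldag i) \<bullet> residual \<eta> i"])
  then have drift: "real b / real p * expectation (\<lambda>\<omega>. gap (?\<eta> \<omega>))
      \<le> expectation (\<lambda>\<omega>. s (?\<eta> \<omega>) (I n \<omega>))"
    unfolding average by (intro mult_left_mono) auto
  have "lyapunov (Suc n) \<le> expectation (\<lambda>\<omega>. ?V \<omega> + ?c * gap (?\<eta> \<omega>) - 2 * s (?\<eta> \<omega>) (I n \<omega>))"
    unfolding lyapunov_def
  proof (rule integral_mono)
    show "integrable M (\<lambda>\<omega>. weighted_dist (multiplier (draws \<omega>) (Suc n)) ldag
        + gain (Suc n) * gap (multiplier (draws \<omega>) (Suc n)))"
      by (rule integrable_multiplier[where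
            f = "\<lambda>\<eta>. weighted_dist \<eta> ldag + gain (Suc n) * gap \<eta>"])
    show "integrable M (\<lambda>\<omega>. ?V \<omega> + ?c * gap (?\<eta> \<omega>) - 2 * s (?\<eta> \<omega>) (I n \<omega>))"
      by (intro Bochner_Integration.integrable_diff Bochner_Integration.integrable_add
          integrable_mult_right int_V int_gap int_s)
    fix \<omega> assume "\<omega> \<in> space M"
    then have J: "I n \<omega> \<in> batches p b" by (rule I_in_batches)
    let ?\<eta>' = "step (I n \<omega>) (?\<eta> \<omega>)"
    have "weighted_dist ?\<eta>' ldag + gap ?\<eta>' / descent_factor
        \<le> weighted_dist (?\<eta> \<omega>) ldag + gap (?\<eta> \<omega>) / descent_factor - 2 * s (?\<eta> \<omega>) (I n \<omega>)"
      using potential_step[OF J, of "?\<eta> \<omega>" ldag] by (simp add: gap_def diff_divide_distrib s_def)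
    moreover have "?c * real (Suc n) * gap ?\<eta>' \<le> ?c * real (Suc n) * gap (?\<eta> \<omega>)"
      using dual_objective_step_le[OF J, of "?\<eta> \<omega>"] by (intro mult_left_mono) (auto simp: gap_def)
    ultimately show "weighted_dist (multiplier (draws \<omega>) (Suc n)) ldag
        + gain (Suc n) * gap (multiplier (draws \<omega>) (Suc n))
        \<le> ?V \<omega> + ?c * gap (?\<eta> \<omega>) - 2 * s (?\<eta> \<omega>) (I n \<omega>)"
      by (simp add: gain_def algebra_simps add_divide_distrib)
  qed
  also have "\<dots> = expectation ?V + ?c * expectation (\<lambda>\<omega>. gap (?\<eta> \<omega>))
      - 2 * expectation (\<lambda>\<omega>. s (?\<eta> \<omega>) (I n \<omega>))"
    using int_V int_gap int_s by simp
  also have "\<dots> \<le> expectation ?V" using drift by simp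
  finally show ?thesis by (simp only: lyapunov_def)
qed

lemma lyapunov_initial:
  "lyapunov 0 \<le> (L2_set (\<lambda>i. norm (ldag i)) {1..p})\<^sup>2 / tmin
    + (conjugate 0 + r xdag + L2_set (\<lambda>i. norm (ldag i)) {1..p} * \<delta>) / descent_factor"
proof -
  let ?l = "L2_set (\<lambda>i. norm (ldag i)) {1..p}"
  have zero: "dual_of (\<lambda>_. 0) = 0" by (rule blinfun_eqI) (simp add: block_adjoint_apply)
  have "lyapunov 0 = weighted_dist (\<lambda>_. 0) ldag + gap (\<lambda>_. 0) / descent_factor"
    by (simp add: lyapunov_def gain_def prob_space)
  moreover have "weighted_dist (\<lambda>_. 0) ldag \<le> ?l\<^sup>2 / tmin"
    using weighted_dist_upper[of "\<lambda>_. 0" ldag] by simp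
  moreover have "gap (\<lambda>_. 0) \<le> conjugate 0 + r xdag + ?l * \<delta>"
    using noise_pairing_le[of ldag] by (simp add: gap_eq zero sum_negf del: One_nat_def)
  then have "gap (\<lambda>_. 0) / descent_factor \<le> (conjugate 0 + r xdag + ?l * \<delta>) / descent_factor"
    using descent_factor_bounds by (intro divide_right_mono) auto
  ultimately show ?thesis by linarith
qed

text \<open>
  This makes \<open>gain n\<close> comparable with \<open>1 + (b/p) n\<close>, uniformly in \<open>p\<close> and \<open>b\<close>.
\<close>
lemma gain_bounds:
  "1 + real b / real p * real n \<le> gain n"
  "gain n \<le> 2 / descent_factor * (1 + real b / real p * real n)"
proof -
  define m where "m = real b / real p * real n"
  have "0 \<le> m" by (simp add: m_def)
  have inv: "1 \<le> 1 / descent_factor" using descent_factor_bounds by simp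
  then show "1 + real b / real p * real n \<le> gain n"
    using \<open>0 \<le> m\<close> unfolding gain_def m_def[symmetric] by linarith
  have "1 * (2 * m) \<le> 1 / descent_factor * (2 * m)"
    using inv \<open>0 \<le> m\<close> by (intro mult_right_mono) auto
  then show "gain n \<le> 2 / descent_factor * (1 + real b / real p * real n)"
    using inv unfolding gain_def m_def[symmetric] by (simp add: distrib_left add_divide_distrib)
qed

lemma primal_eq_multiplier:
  "\<omega> \<in> space M \<Longrightarrow> smd_primal R A yd t (draws \<omega>) n = primal_of (multiplier (draws \<omega>) n)"
  unfolding smd_primal_def by (subst smd_dual_eq_multiplier) (auto intro: I_in_batches)

lemma integrable_error:
  "integrable M (\<lambda>\<omega>. (norm (smd_primal R A yd t (draws \<omega>) n - xdag))\<^sup>2)"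
  using integrable_multiplier[of "\<lambda>\<eta>. (norm (primal_of \<eta> - xdag))\<^sup>2" n]
  by (simp add: primal_eq_multiplier cong: Bochner_Integration.integrable_cong)

lemma gain_expected_error_le:
  "gain n * \<sigma> * expectation (\<lambda>\<omega>. (norm (smd_primal R A yd t (draws \<omega>) n - xdag))\<^sup>2)
    \<le> lyapunov 0 + (gain n * \<delta>)\<^sup>2 * tmax / 4"
proof -
  have "0 \<le> real b / real p * real n" by simp
  then have pos: "gain n \<ge> 0" using gain_bounds(1)[of n] by linarith
  have "gain n * \<sigma> * expectation (\<lambda>\<omega>. (norm (smd_primal R A yd t (draws \<omega>) n - xdag))\<^sup>2)
      = expectation (\<lambda>\<omega>. gain n * \<sigma> * (norm (primal_of (multiplier (draws \<omega>) n) - xdag))\<^sup>2)"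
    by (simp add: primal_eq_multiplier cong: Bochner_Integration.integral_cong)
  also have "\<dots> \<le> expectation (\<lambda>\<omega>. weighted_dist (multiplier (draws \<omega>) n) ldag
      + gain n * gap (multiplier (draws \<omega>) n) + (gain n * \<delta>)\<^sup>2 * tmax / 4)"
    by (intro integral_mono integrable_multiplier error_le_lyapunov pos
        integrable_multiplier[where f = "\<lambda>\<eta>. weighted_dist \<eta> ldag + gain n * gap \<eta> + (gain n * \<delta>)\<^sup>2 * tmax / 4"]
        integrable_multiplier[where f = "\<lambda>\<eta>. gain n * \<sigma> * (norm (primal_of \<eta> - xdag))\<^sup>2"])
  also have "\<dots> = lyapunov n + (gain n * \<delta>)\<^sup>2 * tmax / 4"
    unfolding lyapunov_def
    using integrable_multiplier[of "\<lambda>\<eta>. weighted_dist \<eta> ldag + gain n * gap \<eta>" n]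
    by (simp add: prob_space)
  also have "lyapunov n \<le> lyapunov 0"
    by (rule lift_Suc_antimono_le[where f = lyapunov, OF lyapunov_decreasing]) simp
  finally show ?thesis by simp
qed

text \<open>
  By the stopping rule \<open>gain n\<close> lies between \<open>c1 / \<delta>\<close> and \<open>2 c2 / (descent_factor \<delta>)\<close>. The lower
  bound provides the factor \<open>\<delta>\<close> of the rate, the upper one bounds the noise term
  \<open>(gain n \<delta>)\<^sup>2\<close>; and \<open>\<delta> \<le> c2\<close>, because \<open>1 \<le> c2 / \<delta>\<close>.
\<close>
lemma expected_error_rate:
  assumes c: "c1 > 0" and \<delta>: "\<delta> > 0"
    and lower: "c1 / \<delta> \<le> 1 + real b / real p * real n"
    and upper: "1 + real b / real p * real n \<le> c2 / \<delta>"
  defines "l \<equiv> L2_set (\<lambda>i. norm (ldag i)) {1..p}"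
  shows "expectation (\<lambda>\<omega>. (norm (smd_primal R A yd t (draws \<omega>) n - xdag))\<^sup>2)
    \<le> (l\<^sup>2 / tmin + (conjugate 0 + r xdag + l * c2) / descent_factor
        + c2\<^sup>2 * tmax / descent_factor\<^sup>2) / (c1 * \<sigma>) * \<delta>"
    (is "?E \<le> ?K / (c1 * \<sigma>) * \<delta>")
proof -
  note d = descent_factor_bounds
  have l: "l \<ge> 0" by (simp add: l_def)
  have E: "?E \<ge> 0" by (rule Bochner_Integration.integral_nonneg) simp
  have "0 \<le> real b / real p * real n" by simp
  then have "1 \<le> c2 / \<delta>" using upper by linarith
  then have "\<delta> \<le> c2" using \<delta> by (simp add: le_divide_eq)
  then have "(conjugate 0 + r xdag + l * \<delta>) / descent_factor
      \<le> (conjugate 0 + r xdag + l * c2) / descent_factor"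
    using l d by (intro divide_right_mono add_left_mono mult_left_mono) auto
  then have init: "lyapunov 0 \<le> l\<^sup>2 / tmin + (conjugate 0 + r xdag + l * c2) / descent_factor"
    using lyapunov_initial by (simp add: l_def)
  have "gain n \<ge> c1 / \<delta>" using gain_bounds(1)[of n] lower by linarith
  moreover have "c1 / \<delta> > 0" using c \<delta> by simp
  ultimately have gain_pos: "gain n > 0" by linarith
  have "gain n \<le> 2 / descent_factor * (c2 / \<delta>)"
    using gain_bounds(2)[of n] upper d
    by (rule_tac order_trans[OF _ mult_left_mono]) auto
  then have "gain n * \<delta> \<le> 2 * c2 / descent_factor"
    using \<delta> d by (simp add: field_simps)
  then have "(gain n * \<delta>)\<^sup>2 \<le> (2 * c2 / descent_factor)\<^sup>2"
    using gain_pos \<delta> by (intro power_mono) auto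
  then have "(gain n * \<delta>)\<^sup>2 * tmax / 4 \<le> (2 * c2 / descent_factor)\<^sup>2 * tmax / 4"
    using tmax_pos by (intro divide_right_mono mult_right_mono) auto
  also have "\<dots> = c2\<^sup>2 * tmax / descent_factor\<^sup>2"
    by (simp add: power_divide power_mult_distrib)
  finally have "gain n * \<sigma> * ?E \<le> ?K" using gain_expected_error_le[of n] init by linarith
  moreover have "c1 / \<delta> * \<sigma> * ?E \<le> gain n * \<sigma> * ?E"
    using \<open>gain n \<ge> c1 / \<delta>\<close> sigma_pos E by (intro mult_right_mono) auto
  ultimately have "c1 / \<delta> * \<sigma> * ?E \<le> ?K" by linarith
  then show ?thesis using c \<delta> sigma_pos by (simp add: field_simps)
qed

end

section \<open>From the step-size rule to the convergence rate\<close>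

text \<open>
  For batches with more than one element the step-size is a constant; otherwise the only batch that
  contains \<open>i\<close> is \<open>{i}\<close>.
\<close>
lemma admissible_step_weights:
  assumes "admissible_steps p b \<sigma> A t"
  shows "\<exists>w. \<forall>J\<in>batches p b. \<forall>i\<in>J. w i = t J"
proof (cases "b > 1")
  case True
  then obtain \<tau> where "\<forall>J\<in>batches p b. t J = \<tau>"
    using assms by (auto simp: admissible_steps_def)
  then show ?thesis by (intro exI[of _ "\<lambda>_. \<tau>"]) auto
next
  case False
  have "J = {i}" if "J \<in> batches p b" "i \<in> J" for J i
  proof -
    have "finite J" using that(1) by (auto simp: batches_def intro: finite_subset)
    then have "card J \<noteq> 0" using that(2) by auto
    then have "card J = 1" using False that(1) by (simp add: batches_def)
    then show ?thesis using that(2) by (auto simp: card_1_singleton_iff)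
  qed
  then show ?thesis by (intro exI[of _ "\<lambda>i. t {i}"]) auto
qed

text \<open>
  If \<open>A\<^sub>J = 0\<close>, the quotient in the step-size rule is infinite, but the product form still holds
  since \<open>\<sigma>\<close> is positive.
\<close>
lemma admissible_step_product:
  assumes "admissible_steps p b \<sigma> A t" "J \<in> batches p b" "\<sigma> > 0"
  shows "t J > 0" and "t J * (block_norm A J)\<^sup>2 < 4 * \<sigma>"
proof -
  have t: "0 < t J" "ereal (t J) < ereal (4 * \<sigma>) / ereal ((block_norm A J)\<^sup>2)"
    using assms by (auto simp: admissible_steps_def)
  show "t J > 0" by (rule t)
  show "t J * (block_norm A J)\<^sup>2 < 4 * \<sigma>"
  proof (cases "block_norm A J = 0")
    case False
    then have "t J < 4 * \<sigma> / (block_norm A J)\<^sup>2" using t(2) by simp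
    then show ?thesis using False by (simp add: pos_less_divide_eq)
  qed (use assms(3) in simp)
qed

text \<open>
  The bound of \<open>expected_error_rate\<close> as a function of the problem data. The summand
  \<open>conjugate 0 + r xdag\<close> is the excess of \<open>R\<close> at \<open>xdag\<close> over its minimum.
\<close>
definition (in strongly_convex_functional) rate_constant ::
  "'x \<Rightarrow> real \<Rightarrow> real \<Rightarrow> real \<Rightarrow> real \<Rightarrow> real \<Rightarrow> real \<Rightarrow> real" where
  "rate_constant xdag c1 c2 l tmin tmax \<kappa> =
    (l\<^sup>2 / tmin + (conjugate 0 + r xdag + l * c2) / (1 - \<kappa> / (4 * \<sigma>))
      + c2\<^sup>2 * tmax / (1 - \<kappa> / (4 * \<sigma>))\<^sup>2) / (c1 * \<sigma>)"

text \<open>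
  The positivity of \<open>\<delta>\<close> is part of the conclusion because the final constant is larger than \<open>rate_constant\<close>.
\<close>
lemma (in strongly_convex_functional) smd_convergence_rate:
  fixes A :: "nat \<Rightarrow> 'x \<Rightarrow>\<^sub>L 'h::real_inner" and t :: "nat set \<Rightarrow> real"
    and M :: "'w measure"
  assumes b: "1 \<le> b" "b \<le> p"
    and xdag: "solves p A y xdag"
    and steps: "admissible_steps p b \<sigma> A t"
    and source: "block_adjoint A {1..p} ldag \<in> subdifferential R xdag"
    and noise: "\<And>i. i \<in> {1..p} \<Longrightarrow> norm (yd i - y i) \<le> del i"
    and del: "\<And>i. i \<in> {1..p} \<Longrightarrow> del i > 0"
    and selections: "uniform_selections p b M I"
    and c: "c1 > 0"
  defines "\<delta> \<equiv> L2_set del {1..p}"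
  assumes stopping: "c1 / \<delta> \<le> 1 + real b / real p * real n" "1 + real b / real p * real n \<le> c2 / \<delta>"
  shows "integrable M (\<lambda>\<omega>. (norm (smd_primal R A yd t (\<lambda>k. I k \<omega>) n - xdag))\<^sup>2)"
    and "prob_space.expectation M (\<lambda>\<omega>. (norm (smd_primal R A yd t (\<lambda>k. I k \<omega>) n - xdag))\<^sup>2)
      \<le> rate_constant xdag c1 c2 (L2_set (\<lambda>i. norm (ldag i)) {1..p})
          (Min (t ` batches p b)) (Max (t ` batches p b))
          (Max ((\<lambda>J. t J * (block_norm A J)\<^sup>2) ` batches p b)) * \<delta>"
    and "\<delta> > 0"
proof -
  let ?B = "batches p b" and ?\<kappa> = "Max ((\<lambda>J. t J * (block_norm A J)\<^sup>2) ` batches p b)"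
  let ?tmin = "Min (t ` ?B)" and ?tmax = "Max (t ` ?B)"
  note B = finite_batches[of p b] batches_nonempty[OF b(2)]
  note step = admissible_step_product[OF steps _ sigma_pos]
  obtain w where w: "\<And>J i. J \<in> ?B \<Longrightarrow> i \<in> J \<Longrightarrow> w i = t J"
    using admissible_step_weights[OF steps] by blast
  have w_between: "?tmin \<le> w i \<and> w i \<le> ?tmax" if i: "i \<in> {1..p}" for i
  proof -
    obtain J where "J \<in> ?B" "i \<in> J" using exists_batch_containing[OF b i] .
    then show ?thesis using w B by auto
  qed
  have tmin: "?tmin > 0" and tmax: "?tmax > 0"
    using step(1) B by (auto simp: Max_gr_iff)
  have \<kappa>: "?\<kappa> < 4 * \<sigma>" using step(2) B by (subst Max_less_iff) auto
  have noise_le: "L2_set (\<lambda>i. norm (yd i - y i)) {1..p} \<le> \<delta>"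
    unfolding \<delta>_def using noise by (intro L2_set_mono) auto
  have "0 < del 1" using del[of 1] b by simp
  also have "del 1 \<le> \<delta>" unfolding \<delta>_def using b by (intro member_le_L2_set) auto
  finally show \<delta>: "\<delta> > 0" .
  interpret M: prob_space M using selections by (simp add: uniform_selections_def)
  interpret noisy_descent R \<sigma> p b A yd t w ?\<kappa> M I y ldag xdag \<delta> ?tmin ?tmax
  proof unfold_locales
    show "solves p A y xdag" by (rule xdag)
    show "block_adjoint A {1..p} ldag \<in> subdifferential R xdag" by (rule source)
    show "L2_set (\<lambda>i. norm (yd i - y i)) {1..p} \<le> \<delta>" by (rule noise_le)
  qed (use b step(1) B \<kappa> w w_between tmin tmax selections in auto)
  show "integrable M (\<lambda>\<omega>. (norm (smd_primal R A yd t (\<lambda>k. I k \<omega>) n - xdag))\<^sup>2)"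
    by (rule integrable_error)
  show "M.expectation (\<lambda>\<omega>. (norm (smd_primal R A yd t (\<lambda>k. I k \<omega>) n - xdag))\<^sup>2)
      \<le> rate_constant xdag c1 c2 (L2_set (\<lambda>i. norm (ldag i)) {1..p}) ?tmin ?tmax ?\<kappa> * \<delta>"
    using expected_error_rate[OF c \<delta> stopping]
    by (simp only: rate_constant_def descent_factor_def)
qed

theorem theorem4p1:
  fixes R :: "'x::banach \<Rightarrow> ereal" and \<sigma> :: real and xdag :: 'x and c\<^sub>1 c\<^sub>2 :: real
  assumes "proper_fun R" and "lower_semicont R"
    and "modulus_of_convexity R \<sigma>" and "\<sigma> > 0"
    and "c\<^sub>1 > 0" and "c\<^sub>2 > 0"
  shows "\<exists>C :: real \<Rightarrow> real \<Rightarrow> real \<Rightarrow> real \<Rightarrow> real.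
    (\<forall>l tmin tmax \<kappa>. C l tmin tmax \<kappa> > 0) \<and>
    (\<forall>(p::nat) (b::nat) (Y :: nat \<Rightarrow> 'h::{real_inner, complete_space} set)
       (A :: nat \<Rightarrow> 'x \<Rightarrow>\<^sub>L 'h) (y :: nat \<Rightarrow> 'h) (t :: nat set \<Rightarrow> real) (ldag :: nat \<Rightarrow> 'h)
       (ydel :: nat \<Rightarrow> 'h) (del :: nat \<Rightarrow> real) (\<delta>::real)
       (M :: 'w measure) (I :: nat \<Rightarrow> 'w \<Rightarrow> nat set) (n::nat).
       b \<in> {1..p} \<and>
       hilbert_components p Y \<and>
       (\<forall>i\<in>{1..p}. range (blinfun_apply (A i)) \<subseteq> Y i \<and> y i \<in> Y i) \<and>
       (\<exists>x\<in>effdom R. solves p A y x) \<and>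
       unique_minimizing_solution R p A y xdag \<and>
       admissible_steps p b \<sigma> A t \<and>
       (\<forall>i\<in>{1..p}. ldag i \<in> Y i) \<and>
       block_adjoint A {1..p} ldag \<in> subdifferential R xdag \<and>
       (\<forall>i\<in>{1..p}. ydel i \<in> Y i \<and> del i > 0 \<and> norm (ydel i - y i) \<le> del i) \<and>
       \<delta> = L2_set del {1..p} \<and>
       uniform_selections p b M I \<and>
       c\<^sub>1 / \<delta> \<le> 1 + real b / real p * real n \<and>
       1 + real b / real p * real n \<le> c\<^sub>2 / \<delta>
       \<longrightarrow>
       integrable M (\<lambda>\<omega>. (norm (smd_primal R A ydel t (\<lambda>k. I k \<omega>) n - xdag))\<^sup>2) \<and>
       prob_space.expectation M
         (\<lambda>\<omega>. (norm (smd_primal R A ydel t (\<lambda>k. I k \<omega>) n - xdag))\<^sup>2)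
       \<le> C (L2_set (\<lambda>i. norm (ldag i)) {1..p})
           (Min (t ` batches p b)) (Max (t ` batches p b))
           (Max ((\<lambda>J. t J * (block_norm A J)\<^sup>2) ` batches p b)) * \<delta>)"
proof -
  interpret strongly_convex_functional R \<sigma>
    using assms by unfold_locales (auto simp: modulus_of_convexity_def)
  define C where "C l tmin tmax \<kappa> = \<bar>rate_constant xdag c\<^sub>1 c\<^sub>2 l tmin tmax \<kappa>\<bar> + 1"
    for l tmin tmax \<kappa>
  \<comment> \<open>\<open>rate_constant\<close> is arbitrary in sign for parameters that no admissible problem has; \<open>C\<close> must be positive everywhere.\<close>
  have bound: "E \<le> rate_constant xdag c\<^sub>1 c\<^sub>2 l tmin tmax \<kappa> * \<delta> \<Longrightarrow> 0 < \<delta> \<Longrightarrow> E \<le> C l tmin tmax \<kappa> * \<delta>"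
    for E l tmin tmax \<kappa> \<delta>
    unfolding C_def by (erule order_trans) (intro mult_right_mono; simp)
  show ?thesis
  proof (rule exI[of _ C], rule conjI, goal_cases)
    case 1
    show ?case by (simp add: C_def add_nonneg_pos)
  next
    case 2
    show ?case
    proof (intro allI impI, elim conjE, goal_cases)
      case (1 p b Y A y t ldag ydel del \<delta> M I n)
      then have xdag: "solves p A y xdag"
        by (simp add: unique_minimizing_solution_def is_arg_min_def)
      have b: "1 \<le> b" "b \<le> p" using \<open>b \<in> {1..p}\<close> by auto
      have noise: "norm (ydel i - y i) \<le> del i" "del i > 0" if "i \<in> {1..p}" for i
        using 1 that by blast+
      note rate = smd_convergence_rate[OF b xdag \<open>admissible_steps p b \<sigma> A t\<close>
          \<open>block_adjoint A {1..p} ldag \<in> subdifferential R xdag\<close> noise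
          \<open>uniform_selections p b M I\<close> \<open>c\<^sub>1 > 0\<close>,
          folded \<open>\<delta> = L2_set del {1..p}\<close>, of n,
          OF _ _ \<open>c\<^sub>1 / \<delta> \<le> _\<close> \<open>_ \<le> c\<^sub>2 / \<delta>\<close>]
      show ?case using rate noise by (intro conjI bound) simp_all
    qed
  qed
qed

end
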